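(* Let \(n\ge2\) and let \(A\) be a real skew-symmetric \(n\times n\) matrix such that \(w(S)=\det(A_S)\in\{0,1\}\) for all \(S\subseteq[n]\). Then \[ \mathrm{Ent}_\mu(f^2)\le n(\log n+2)\,\mathcal E_P(f,f)\qquad\text{for every }f:\Omega\to\mathbb R. \] Consequently there is an absolute constant \(c\) such that for every \(0<\varepsilon<1\), from every starting state in \(\Omega\), the walk \(P\) is within total variation distance \(\varepsilon\) of \(\mu\) after at most \(c\, n\log n\,[1+\log n+\log(1/\varepsilon)]\) steps.
   Context: For \(S\subseteq[n]\), \(A_S\) is the principal submatrix of \(A\) on \(S\) and \(w(S)=\det(A_S)\) (empty determinant \(1\)). \(Z=\sum_S w(S)\), \(\Omega=\{S:w(S)>0\}\), \(\mu(S)=w(S)/Z\). The flip–repair walk \(P\) on \(\Omega\): from \(S\in\Omega\), choose \(i\in[n]\) uniformly and set \(Y=S\triangle\{i\}\); then move to \(T\in\Omega\) with \(|T\triangle Y|=1\) with probability \(w(T)/\sum_{j=1}^n w(Y\triangle\{j\})\). \(\mathcal E_P(f,f)=\frac12\sum_{x,y}\mu(x)P(x,y)(f(x)-f(y))^2\). For \(g\ge0\), \(\mathrm{Ent}_\mu(g)=\mathbb E_\mu[g\log g]-\mathbb E_\mu[g]\log\mathbb E_\mu[g]\), natural logarithm, \(0\log0=0\). *)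

theory Defs
  imports Complex_Main
    "Jordan_Normal_Form.Determinant"
    "Jordan_Normal_Form.DL_Submatrix"
begin

text \<open>
  The index set \<open>[n]\<close> is rendered as \<open>{0..<n}\<close>, matching the row and column indices of a matrix
  in \<open>carrier_mat n n\<close>. The size \<open>n\<close> is a natural number rather than a type, so that a constant can
  be chosen independently of it.
\<close>

definition minor_weight :: "real mat \<Rightarrow> nat set \<Rightarrow> real" where
  "minor_weight A S = det (submatrix A S S)"

definition partition_sum :: "nat \<Rightarrow> real mat \<Rightarrow> real" where
  "partition_sum n A = (\<Sum>S\<in>Pow {0..<n}. minor_weight A S)"

definition states :: "nat \<Rightarrow> real mat \<Rightarrow> nat set set" where
  "states n A = {S. S \<subseteq> {0..<n} \<and> minor_weight A S > 0}"

definition minor_measure :: "nat \<Rightarrow> real mat \<Rightarrow> nat set \<Rightarrow> real" where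
  "minor_measure n A S = minor_weight A S / partition_sum n A"

text \<open>
  \<open>repair n A Y T\<close> is the probability of moving from the intermediate set \<open>Y\<close> to \<open>T\<close>, and
  \<open>flip_repair n A S T\<close> averages it over the uniformly chosen flip \<open>Y = S \<triangle> {i}\<close>. The kernel is
  meant for \<open>S \<in> states n A\<close>; then every denominator that occurs contains the summand
  \<open>minor_weight A S\<close>. Outcomes \<open>T = S\<close> are included.
\<close>

definition repair :: "nat \<Rightarrow> real mat \<Rightarrow> nat set \<Rightarrow> nat set \<Rightarrow> real" where
  "repair n A Y T =
     (if T \<in> states n A \<and> card (sym_diff T Y) = 1
      then minor_weight A T / (\<Sum>j\<in>{0..<n}. minor_weight A (sym_diff Y {j}))
      else 0)"

definition flip_repair :: "nat \<Rightarrow> real mat \<Rightarrow> nat set \<Rightarrow> nat set \<Rightarrow> real" where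
  "flip_repair n A S T = (\<Sum>i\<in>{0..<n}. (1 / real n) * repair n A (sym_diff S {i}) T)"

text \<open>
  Notions for a kernel \<open>P\<close> and weights \<open>\<mu>\<close> on a finite state space \<open>X\<close>. Functions on \<open>X\<close> are
  functions on the ambient type whose values outside \<open>X\<close> are never used.
\<close>

definition dirichlet_form ::
    "'a set \<Rightarrow> ('a \<Rightarrow> real) \<Rightarrow> ('a \<Rightarrow> 'a \<Rightarrow> real) \<Rightarrow> ('a \<Rightarrow> real) \<Rightarrow> real" where
  "dirichlet_form X \<mu> P f = (1 / 2) * (\<Sum>x\<in>X. \<Sum>y\<in>X. \<mu> x * P x y * (f x - f y)\<^sup>2)"

definition expect :: "'a set \<Rightarrow> ('a \<Rightarrow> real) \<Rightarrow> ('a \<Rightarrow> real) \<Rightarrow> real" where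
  "expect X \<mu> g = (\<Sum>x\<in>X. \<mu> x * g x)"

text \<open>The convention \<open>0 log 0 = 0\<close> holds automatically, since \<open>ln 0\<close> is multiplied by \<open>0\<close>.\<close>

definition entropy :: "'a set \<Rightarrow> ('a \<Rightarrow> real) \<Rightarrow> ('a \<Rightarrow> real) \<Rightarrow> real" where
  "entropy X \<mu> g = expect X \<mu> (\<lambda>x. g x * ln (g x)) - expect X \<mu> g * ln (expect X \<mu> g)"

text \<open>\<open>kernel_power X P t x y\<close> is \<open>P\<^sup>t(x,y)\<close>, the law at time \<open>t\<close> of the chain started at \<open>x\<close>.\<close>

fun kernel_power :: "'a set \<Rightarrow> ('a \<Rightarrow> 'a \<Rightarrow> real) \<Rightarrow> nat \<Rightarrow> 'a \<Rightarrow> 'a \<Rightarrow> real" where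
  "kernel_power X P 0 x y = (if x = y then 1 else 0)"
| "kernel_power X P (Suc t) x y = (\<Sum>z\<in>X. kernel_power X P t x z * P z y)"

definition tv_dist :: "'a set \<Rightarrow> ('a \<Rightarrow> real) \<Rightarrow> ('a \<Rightarrow> real) \<Rightarrow> real" where
  "tv_dist X \<mu> \<nu> = (1 / 2) * (\<Sum>x\<in>X. \<bar>\<mu> x - \<nu> x\<bar>)"

end

theory Submission
  imports Defs "HOL-Analysis.Convex"
begin

text \<open>
  Write \<open>w(S) = \<psi>(S)\<^sup>2\<close> with \<open>\<psi>\<close> the Pfaffian, viewed as a vector in fermionic Fock space, where the
  flip of coordinate \<open>j\<close> is the operator \<open>\<gamma>\<^sub>j\<close> (\<open>amp\<close> below, with the Jordan-Wigner sign). The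
  Pfaffian expansions give the Wick relations, which say that \<open>\<psi>\<close> is the vacuum of annihilators spanning
  a maximal isotropic space \<open>L\<close>. For an intermediate set \<open>Y\<close>, the vector \<open>(\<gamma>\<^sub>j \<psi> (Y))\<^sub>j\<close> lies in \<open>L\<close>, so
  the variance of \<open>f\<close> over the neighbours of \<open>Y\<close> is at least the squared distance of \<open>(\<gamma>\<^sub>j (f \<psi>) (Y))\<^sub>j\<close> to \<open>L\<close>.
  Summed over \<open>Y\<close> this is the expected particle number of \<open>f \<psi>\<close> relative to the vacuum \<open>\<psi>\<close>, a quadratic
  form which the anticommutation relations bound below by a sum over coordinates \<open>e\<close> of the
  two-point terms \<open>p\<^sub>e q\<^sub>e (F\<^sub>0 - F\<^sub>1)\<^sup>2\<close>, where \<open>F\<^sub>b\<close> is the \<open>L\<^sup>2\<close> norm of \<open>f\<close> conditioned on the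
  value of coordinate \<open>e\<close>.

  For weights in \<open>{0, 1}\<close> an exchange argument gives \<open>p\<^sub>e, q\<^sub>e \<ge> 1/n\<close>, so the two-point logarithmic Sobolev
  constant is at most \<open>ln n + 2\<close>. Averaging the chain rule for the entropy over the first revealed coordinate
  and inducting on the number of free coordinates yields the inequality. Since the entropy over the
  neighbours of \<open>Y\<close> dominates the variance of the square root, the relative entropy contracts by
  \<open>1 - 1/(n (ln n + 2))\<close> in every step, whence the mixing time.
\<close>

section \<open>Pfaffians of principal submatrices\<close>

definition flip :: "nat \<Rightarrow> nat set \<Rightarrow> nat set" where
  "flip j Y = sym_diff Y {j}"

text \<open>The Jordan-Wigner sign. The inequality is strict, so the sign does not see whether
  \<open>j\<close> itself belongs to \<open>Y\<close>; hence one sign serves both for inserting and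
  for removing \<open>j\<close>.\<close>

definition sgn_at :: "nat \<Rightarrow> nat set \<Rightarrow> real" where
  "sgn_at j Y = (-1) ^ card {i \<in> Y. i < j}"

lemma mem_flip [simp]: "i \<in> flip j Y \<longleftrightarrow> (i \<in> Y) \<noteq> (i = j)"
  by (auto simp: flip_def)

lemma flip_flip [simp]: "flip j (flip j Y) = Y"
  by (auto simp: set_eq_iff)

lemma flip_commute: "flip j (flip k Y) = flip k (flip j Y)"
  by (auto simp: set_eq_iff)

lemma flip_subset: "j \<in> S \<Longrightarrow> flip j Y \<subseteq> S \<longleftrightarrow> Y \<subseteq> S"
  by (auto simp: flip_def)

lemma flip_insert: "j \<notin> Y \<Longrightarrow> flip j Y = insert j Y"
  by (auto simp: flip_def)

lemma flip_remove: "j \<in> Y \<Longrightarrow> flip j Y = Y - {j}"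
  by (auto simp: flip_def)

lemma sgn_at_square [simp]: "sgn_at j Y * sgn_at j Y = 1"
  by (simp add: sgn_at_def flip: power_add mult_2)

lemma sgn_at_square' [simp]: "sgn_at j Y * (sgn_at j Y * x) = x"
  by (simp flip: mult.assoc)

lemma sgn_at_insert:
  assumes "k \<notin> Y"
  shows "sgn_at j (insert k Y) = (if k < j then - sgn_at j Y else sgn_at j Y)"
proof (cases "k < j")
  case True
  then have "{i \<in> insert k Y. i < j} = insert k {i \<in> Y. i < j}"
    by auto
  with True assms show ?thesis
    by (simp add: sgn_at_def)
next
  case False
  then have "{i \<in> insert k Y. i < j} = {i \<in> Y. i < j}"
    by auto
  with False show ?thesis
    by (simp add: sgn_at_def)
qed

lemma sgn_at_insert_self [simp]: "sgn_at j (insert j Y) = sgn_at j Y"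
  by (cases "j \<in> Y") (auto simp: insert_absorb sgn_at_insert)

lemma sgn_at_remove:
  assumes "k \<in> Y"
  shows "sgn_at j (Y - {k}) = (if k < j then - sgn_at j Y else sgn_at j Y)"
  using sgn_at_insert[of k "Y - {k}" j] assms by (simp add: insert_absorb split: if_splits)

lemma sgn_at_flip: "sgn_at j (flip k Y) = (if k < j then - sgn_at j Y else sgn_at j Y)"
  by (cases "k \<in> Y") (simp_all add: flip_insert flip_remove sgn_at_insert sgn_at_remove)

text \<open>Anticommutation of two removals: exactly one of \<open>j < k\<close> and
  \<open>k < j\<close> holds, so exactly one of the two orders picks up an extra sign.\<close>

lemma sgn_at_remove_swap:
  assumes "j \<in> Y" "k \<in> Y" "j \<noteq> k"
  shows "sgn_at j Y * sgn_at k (Y - {j}) = - (sgn_at k Y * sgn_at j (Y - {k}))"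
  using assms by (auto simp: sgn_at_remove)

lemma sgn_at_insert_remove_swap:
  assumes "i \<notin> Y" "k \<in> Y"
  shows "sgn_at i Y * sgn_at k (insert i Y) = - (sgn_at k Y * sgn_at i (Y - {k}))"
  using assms by (auto simp: sgn_at_insert sgn_at_remove)

text \<open>Expansion along the largest index. The recursion runs over the bound \<open>n\<close>
  instead of the set, so that termination is structural and an index absent from \<open>X\<close> is
  skipped; the sets meant are those with \<open>X \<subseteq> {0..<n}\<close>. The leading sign
  makes the value on \<open>{0, 1}\<close> equal to \<open>- a 1 0\<close>.\<close>

fun pfaffian :: "(nat \<Rightarrow> nat \<Rightarrow> real) \<Rightarrow> nat \<Rightarrow> nat set \<Rightarrow> real" where
  "pfaffian a 0 X = (if X = {} then 1 else 0)"
| "pfaffian a (Suc n) X =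
     (if n \<in> X
      then sgn_at n (X - {n}) *
        (\<Sum>j\<in>X - {n}. a n j * sgn_at j (X - {n}) * pfaffian a n (X - {n} - {j}))
      else pfaffian a n X)"

text \<open>In Fock-space terms: annihilating \<open>i\<close> in \<open>\<psi>\<close> gives the
  same vector as applying the creation operators with coefficients \<open>a i j\<close>. For
  \<open>i \<in> Y\<close> this is the vanishing of an expansion with a repeated row, otherwise the
  Pfaffian expansion along row \<open>i\<close>, for every row and not only the last.\<close>

definition row_expansion :: "(nat \<Rightarrow> nat \<Rightarrow> real) \<Rightarrow> (nat set \<Rightarrow> real) \<Rightarrow> nat set \<Rightarrow> bool" where
  "row_expansion a \<psi> S \<longleftrightarrow> (\<forall>i\<in>S. \<forall>Y\<subseteq>S.
     (\<Sum>j\<in>Y. a i j * sgn_at j Y * \<psi> (Y - {j})) =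
       (if i \<in> Y then 0 else sgn_at i Y * \<psi> (insert i Y)))"

lemma sum_remove_swap:
  fixes g :: "nat \<Rightarrow> nat \<Rightarrow> real"
  assumes "finite Z"
  shows "(\<Sum>j\<in>Z. \<Sum>k\<in>Z - {j}. g j k) = (\<Sum>k\<in>Z. \<Sum>j\<in>Z - {k}. g j k)"
proof -
  have "(\<Sum>j\<in>Z. \<Sum>k\<in>Z - {j}. g j k) = (\<Sum>j\<in>Z. \<Sum>k\<in>Z. if k = j then 0 else g j k)"
    using assms by (intro sum.cong refl sum.mono_neutral_cong_left) auto
  also have "\<dots> = (\<Sum>k\<in>Z. \<Sum>j\<in>Z. if k = j then 0 else g j k)"
    by (rule sum.swap)
  also have "\<dots> = (\<Sum>k\<in>Z. \<Sum>j\<in>Z - {k}. g j k)"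
    using assms by (intro sum.cong refl sum.mono_neutral_cong_right) auto
  finally show ?thesis .
qed

text \<open>The recursion itself is the case \<open>i = n\<close>, \<open>n \<notin> Y\<close>; the
  induction transports it to the other cases. When \<open>n \<in> Y\<close>, expanding each
  \<open>q (Y - {j})\<close> along \<open>n\<close> gives a double sum, and anticommuting the two
  removals turns its inner sum into an expansion \<open>B i (Z - {k})\<close> for the smaller
  bound.\<close>

lemma row_expansion_pfaffian:
  assumes skew: "\<And>i j. a i j = - a j i"
  shows "row_expansion a (pfaffian a n) {0..<n}"
proof (induction n)
  case 0
  then show ?case by (simp add: row_expansion_def)
next
  case (Suc n)
  define p where "p = pfaffian a n"
  define q where "q = pfaffian a (Suc n)"
  define B where "B i Y = (\<Sum>j\<in>Y. a i j * sgn_at j Y * p (Y - {j}))" for i Y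
  have IH: "B i Y = (if i \<in> Y then 0 else sgn_at i Y * p (insert i Y))"
    if "i < n" "Y \<subseteq> {0..<n}" for i Y
    using Suc.IH that unfolding row_expansion_def B_def p_def by auto
  have q_old: "q X = p X" if "n \<notin> X" for X
    using that by (simp add: q_def p_def)
  have q_new: "q (insert n Z) = sgn_at n Z * B n Z" if "n \<notin> Z" for Z
    using that by (simp add: q_def p_def B_def)
  have diag: "a i i = 0" for i
    using skew[of i i] by simp
  have goal: "(\<Sum>j\<in>Y. a i j * sgn_at j Y * q (Y - {j})) =
       (if i \<in> Y then 0 else sgn_at i Y * q (insert i Y))"
    if i: "i < Suc n" and Y: "Y \<subseteq> {0..<Suc n}" for i Y
  proof (cases "n \<in> Y")
    case False
    then have Yn: "Y \<subseteq> {0..<n}"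
      using Y by (auto simp: less_Suc_eq)
    have "(\<Sum>j\<in>Y. a i j * sgn_at j Y * q (Y - {j})) = B i Y"
      unfolding B_def using False by (intro sum.cong) (auto simp: q_old)
    then show ?thesis
      using False i IH[OF _ Yn, of i] by (cases "i = n") (auto simp: q_old q_new)
  next
    case True
    define Z where "Z = Y - {n}"
    have YZ: "Y = insert n Z" and nZ: "n \<notin> Z" and Zn: "Z \<subseteq> {0..<n}"
      using True Y by (auto simp: Z_def less_Suc_eq)
    have finZ: "finite Z"
      using Zn finite_subset by blast
    have "(\<Sum>j\<in>Z. a i j * sgn_at j Y * q (Y - {j}))
        = (\<Sum>j\<in>Z. \<Sum>k\<in>Z - {j}. - sgn_at n Z * (a i j * a n k
             * (sgn_at j Z * sgn_at k (Z - {j})) * p (Z - {j} - {k})))"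
    proof (intro sum.cong refl)
      fix j assume j: "j \<in> Z"
      then have "j < n" using Zn by auto
      have "Y - {j} = insert n (Z - {j})"
        using j nZ by (auto simp: YZ)
      moreover have "sgn_at n (Z - {j}) = - sgn_at n Z"
        using j \<open>j < n\<close> by (simp add: sgn_at_remove)
      moreover have "sgn_at j Y = sgn_at j Z"
        using \<open>j < n\<close> nZ by (simp add: YZ sgn_at_insert)
      ultimately show "a i j * sgn_at j Y * q (Y - {j}) =
          (\<Sum>k\<in>Z - {j}. - sgn_at n Z * (a i j * a n k
             * (sgn_at j Z * sgn_at k (Z - {j})) * p (Z - {j} - {k})))"
        using nZ by (simp add: q_new B_def sum_distrib_left mult_ac)
    qed
    also have "\<dots> = (\<Sum>k\<in>Z. \<Sum>j\<in>Z - {k}. - sgn_at n Z * (a i j * a n k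
             * (sgn_at j Z * sgn_at k (Z - {j})) * p (Z - {j} - {k})))"
      by (rule sum_remove_swap[OF finZ])
    also have "\<dots> = (\<Sum>k\<in>Z. sgn_at n Z * (a n k * sgn_at k Z * B i (Z - {k})))"
    proof (intro sum.cong refl)
      fix k assume k: "k \<in> Z"
      have "- sgn_at n Z * (a i j * a n k * (sgn_at j Z * sgn_at k (Z - {j})) * p (Z - {j} - {k}))
          = sgn_at n Z * (a n k * sgn_at k Z * (a i j * sgn_at j (Z - {k}) * p (Z - {k} - {j})))"
        if "j \<in> Z - {k}" for j
      proof -
        have "sgn_at j Z * sgn_at k (Z - {j}) = - (sgn_at k Z * sgn_at j (Z - {k}))"
          using sgn_at_remove_swap[of j Z k] that k by auto
        moreover have "Z - {j} - {k} = Z - {k} - {j}" by auto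
        ultimately show ?thesis by simp
      qed
      then show "(\<Sum>j\<in>Z - {k}. - sgn_at n Z * (a i j * a n k
             * (sgn_at j Z * sgn_at k (Z - {j})) * p (Z - {j} - {k})))
          = sgn_at n Z * (a n k * sgn_at k Z * B i (Z - {k}))"
        unfolding B_def sum_distrib_left by (intro sum.cong) auto
    qed
    finally have dbl: "(\<Sum>j\<in>Z. a i j * sgn_at j Y * q (Y - {j}))
        = sgn_at n Z * (\<Sum>k\<in>Z. a n k * sgn_at k Z * B i (Z - {k}))"
      by (simp add: sum_distrib_left)
    have lhs: "(\<Sum>j\<in>Y. a i j * sgn_at j Y * q (Y - {j}))
        = sgn_at n Z * (a i n * p Z + (\<Sum>k\<in>Z. a n k * sgn_at k Z * B i (Z - {k})))"
    proof -
      have "(\<Sum>j\<in>Y. a i j * sgn_at j Y * q (Y - {j}))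
          = a i n * sgn_at n Y * q (Y - {n}) + (\<Sum>j\<in>Z. a i j * sgn_at j Y * q (Y - {j}))"
        using finZ nZ by (simp add: YZ)
      moreover have "q (Y - {n}) = p Z" using nZ by (simp add: YZ q_old)
      ultimately show ?thesis
        unfolding dbl by (simp add: YZ distrib_left)
    qed
    show ?thesis
    proof (cases "i = n")
      case iN: True
      \<comment> \<open>The double sum is antisymmetric in its two removed indices, hence zero; the
        remaining term of \<open>lhs\<close> has the factor \<open>a n n = 0\<close>.\<close>
      let ?T = "\<lambda>j k. a n j * a n k * (sgn_at k Z * sgn_at j (Z - {k})) * p (Z - {k} - {j})"
      have T: "(\<Sum>k\<in>Z. a n k * sgn_at k Z * B n (Z - {k})) = (\<Sum>k\<in>Z. \<Sum>j\<in>Z - {k}. ?T j k)"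
        by (simp add: B_def sum_distrib_left mult_ac)
      also have "\<dots> = (\<Sum>j\<in>Z. \<Sum>k\<in>Z - {j}. ?T j k)"
        by (rule sum_remove_swap[OF finZ])
      also have "\<dots> = (\<Sum>j\<in>Z. \<Sum>k\<in>Z - {j}. - ?T k j)"
      proof (intro sum.cong refl)
        fix j k assume jk: "j \<in> Z" "k \<in> Z - {j}"
        have "Z - {j} - {k} = Z - {k} - {j}" by auto
        then show "?T j k = - ?T k j"
          using sgn_at_remove_swap[of j Z k] jk by auto
      qed
      also have "\<dots> = - (\<Sum>k\<in>Z. \<Sum>j\<in>Z - {k}. ?T j k)"
        by (simp add: sum_negf)
      finally have "(\<Sum>k\<in>Z. a n k * sgn_at k Z * B n (Z - {k})) = 0"
        using T by linarith
      then show ?thesis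
        using iN True lhs diag by simp
    next
      case False
      then have i_n: "i < n" using i by simp
      show ?thesis
      proof (cases "i \<in> Z")
        case iZ: True
        \<comment> \<open>The inner expansion has a repeated row unless \<open>i\<close> is the
          removed index; the survivor \<open>a n i * p Z\<close> cancels \<open>a i n * p Z\<close>
          by skewness.\<close>
        have "(\<Sum>k\<in>Z. a n k * sgn_at k Z * B i (Z - {k})) = (\<Sum>k\<in>Z. if k = i then a n i * p Z else 0)"
        proof (intro sum.cong refl)
          fix k assume k: "k \<in> Z"
          have Zk: "Z - {k} \<subseteq> {0..<n}" using Zn by blast
          have "B i (Z - {k}) = (if k = i then sgn_at i (Z - {i}) * p Z else 0)"
            using IH[OF i_n Zk] iZ by (auto simp: insert_absorb)
          then show "a n k * sgn_at k Z * B i (Z - {k}) = (if k = i then a n i * p Z else 0)"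
            using iZ by (simp add: sgn_at_remove)
        qed
        also have "\<dots> = a n i * p Z"
          using finZ iZ by simp
        finally show ?thesis
          using lhs iZ skew[of i n] by (simp add: YZ)
      next
        case iZ: False
        \<comment> \<open>Here \<open>q (insert i Y)\<close> is expanded along \<open>n\<close> as
          well; anticommuting the insertion of \<open>i\<close> with the removal of \<open>k\<close>
          matches the two sides term by term.\<close>
        have sgn_nZ: "sgn_at n (insert i Z) = - sgn_at n Z"
          using iZ i_n by (simp add: sgn_at_insert)
        have "q (insert i Y) = sgn_at n (insert i Z) * B n (insert i Z)"
          using q_new[of "insert i Z"] nZ False by (simp add: YZ insert_commute)
        also have "B n (insert i Z) = a n i * sgn_at i Z * p Z
            + (\<Sum>k\<in>Z. a n k * sgn_at k (insert i Z) * p (insert i (Z - {k})))"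
        proof -
          have "insert i Z - {k} = insert i (Z - {k})" if "k \<in> Z" for k
            using that iZ by auto
          then show ?thesis
            using finZ iZ by (simp add: B_def)
        qed
        finally have q_ins0: "q (insert i Y) = sgn_at n (insert i Z) * (a n i * sgn_at i Z * p Z
            + (\<Sum>k\<in>Z. a n k * sgn_at k (insert i Z) * p (insert i (Z - {k}))))" .
        have q_ins: "sgn_at i Y * q (insert i Y) = - sgn_at n Z * (a n i * p Z
            + (\<Sum>k\<in>Z. a n k * (sgn_at i Z * sgn_at k (insert i Z)) * p (insert i (Z - {k}))))"
        proof -
          have "(\<Sum>k\<in>Z. a n k * (sgn_at i Z * sgn_at k (insert i Z)) * p (insert i (Z - {k})))
              = sgn_at i Z * (\<Sum>k\<in>Z. a n k * sgn_at k (insert i Z) * p (insert i (Z - {k})))"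
            by (simp add: sum_distrib_left mult_ac)
          moreover have "sgn_at i Y = sgn_at i Z"
            using i_n nZ by (simp add: YZ sgn_at_insert)
          moreover have "s * (- t * (x * s * y + R)) = - t * (x * y + s * R)"
            if "s * s = 1" for s t x y R :: real
          proof -
            have "s * (- t * (x * s * y + R)) = - t * ((s * s) * (x * y) + s * R)"
              by (simp only: algebra_simps)
            then show ?thesis using that by simp
          qed
          ultimately show ?thesis
            using q_ins0 by (simp add: sgn_nZ)
        qed
        have "(\<Sum>k\<in>Z. a n k * sgn_at k Z * B i (Z - {k}))
            = - (\<Sum>k\<in>Z. a n k * (sgn_at i Z * sgn_at k (insert i Z)) * p (insert i (Z - {k})))"
          unfolding sum_negf[symmetric]
        proof (intro sum.cong refl)
          fix k assume k: "k \<in> Z"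
          have Zk: "Z - {k} \<subseteq> {0..<n}" using Zn by blast
          have "B i (Z - {k}) = sgn_at i (Z - {k}) * p (insert i (Z - {k}))"
            using IH[OF i_n Zk] iZ by auto
          then show "a n k * sgn_at k Z * B i (Z - {k}) =
              - (a n k * (sgn_at i Z * sgn_at k (insert i Z)) * p (insert i (Z - {k})))"
            using sgn_at_insert_remove_swap[OF iZ k] by simp
        qed
        then show ?thesis
          using lhs q_ins iZ False skew[of i n] by (simp add: YZ algebra_simps)
      qed
    qed
  qed
  then show ?case
    unfolding row_expansion_def q_def by auto
qed

section \<open>Minors with prescribed lists of rows and columns\<close>

definition remove_nth :: "nat \<Rightarrow> 'a list \<Rightarrow> 'a list" where
  "remove_nth p xs = take p xs @ drop (Suc p) xs"

lemma length_remove_nth: "p < length xs \<Longrightarrow> length (remove_nth p xs) = length xs - 1"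
  by (simp add: remove_nth_def)

lemma nth_remove_nth:
  assumes "p < length xs" "i < length xs - 1"
  shows "remove_nth p xs ! i = xs ! (if i < p then i else Suc i)"
  using assms by (auto simp: remove_nth_def nth_append min_def)

lemma remove_nth_Cons [simp]:
  "remove_nth 0 (x # xs) = xs" "remove_nth (Suc p) (x # xs) = x # remove_nth p xs"
  by (simp_all add: remove_nth_def)

lemma distinct_remove_nth:
  assumes "distinct xs" "p < length xs"
  shows "distinct (remove_nth p xs)" "set (remove_nth p xs) = set xs - {xs ! p}"
proof -
  have xs: "xs = take p xs @ xs ! p # drop (Suc p) xs"
    using assms(2) by (rule id_take_nth_drop)
  have d: "distinct (take p xs @ xs ! p # drop (Suc p) xs)"
    using assms(1) xs by simp
  then show "distinct (remove_nth p xs)"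
    by (simp add: remove_nth_def)
  have "set xs = set (take p xs @ xs ! p # drop (Suc p) xs)"
    using xs by simp
  then show "set (remove_nth p xs) = set xs - {xs ! p}"
    using d by (auto simp: remove_nth_def)
qed

text \<open>Lists fix an order of the rows and columns and let the two differ, so that a minor with
  one exchanged index is \<open>k # xs\<close> against \<open>i # xs\<close>, without counting
  positions.\<close>

definition minor_list :: "(nat \<Rightarrow> nat \<Rightarrow> real) \<Rightarrow> nat list \<Rightarrow> nat list \<Rightarrow> real" where
  "minor_list a rs cs = det (mat (length rs) (length rs) (\<lambda>(p, q). a (rs ! p) (cs ! q)))"

lemma minor_list_expand:
  assumes p: "p < length rs" and len: "length cs = length rs"
  shows "minor_list a rs cs = (\<Sum>q<length rs. a (rs ! p) (cs ! q)
      * ((-1) ^ (p + q) * minor_list a (remove_nth p rs) (remove_nth q cs)))"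
proof -
  define M where "M = mat (length rs) (length rs) (\<lambda>(p, q). a (rs ! p) (cs ! q))"
  have M: "M \<in> carrier_mat (length rs) (length rs)"
    by (simp add: M_def)
  have "M $$ (p, q) * cofactor M p q = a (rs ! p) (cs ! q)
      * ((-1) ^ (p + q) * minor_list a (remove_nth p rs) (remove_nth q cs))"
    if q: "q < length rs" for q
  proof -
    have "mat_delete M p q = mat (length (remove_nth p rs)) (length (remove_nth p rs))
        (\<lambda>(i, j). a (remove_nth p rs ! i) (remove_nth q cs ! j))"
      using p q len
      by (intro eq_matI) (auto simp: mat_delete_def M_def length_remove_nth nth_remove_nth)
    then show ?thesis
      using p q by (simp add: cofactor_def minor_list_def M_def)
  qed
  then show ?thesis
    unfolding minor_list_def M_def[symmetric] laplace_expansion_row[OF M p] by simp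
qed

lemma minor_list_move_row:
  assumes p: "p < length rs" and len: "length cs = length rs"
  shows "minor_list a (rs ! p # remove_nth p rs) cs = (-1) ^ p * minor_list a rs cs"
proof -
  have p0: "0 < length rs"
    using p by linarith
  have l: "length (rs ! p # remove_nth p rs) = length rs"
    using p by (simp add: length_remove_nth)
  have sign: "x * ((-1) ^ q * y) = (-1) ^ p * (x * ((-1) ^ (p + q) * y))" for q and x y :: real
    by (cases "even p"; cases "even q") simp_all
  have "minor_list a (rs ! p # remove_nth p rs) cs = (\<Sum>q<length rs. a (rs ! p) (cs ! q)
      * ((-1) ^ q * minor_list a (remove_nth p rs) (remove_nth q cs)))"
    using minor_list_expand[of 0 "rs ! p # remove_nth p rs" cs a] p0 len
    unfolding l by simp
  also have "\<dots> = (-1) ^ p * minor_list a rs cs"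
    unfolding minor_list_expand[OF p len] sum_distrib_left
    by (intro sum.cong refl sign)
  finally show ?thesis .
qed

text \<open>Expansion along row \<open>k\<close>. Moving row \<open>p\<close> of \<open>xs\<close>
  to the front costs \<open>(-1) ^ p\<close> against the cofactor sign \<open>(-1) ^ Suc p\<close>,
  so every remaining minor is again a bordered principal minor, with a shorter list and a uniform
  sign. This shape lets the next induction close.\<close>

lemma minor_list_border:
  "minor_list a (k # xs) (i # xs) = a k i * minor_list a xs xs
     - (\<Sum>p<length xs. a k (xs ! p) *
         minor_list a (xs ! p # remove_nth p xs) (i # remove_nth p xs))"
proof -
  have "minor_list a (k # xs) (i # xs) = a k i * minor_list a xs xs
      + (\<Sum>p<length xs. a k (xs ! p) * ((-1) ^ Suc p * minor_list a xs (i # remove_nth p xs)))"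
    by (subst minor_list_expand[of 0]) (simp_all add: sum.lessThan_Suc_shift del: sum.lessThan_Suc)
  also have "(\<Sum>p<length xs. a k (xs ! p) * ((-1) ^ Suc p * minor_list a xs (i # remove_nth p xs)))
      = (\<Sum>p<length xs. - (a k (xs ! p) *
         minor_list a (xs ! p # remove_nth p xs) (i # remove_nth p xs)))"
    by (intro sum.cong refl) (simp add: minor_list_move_row length_remove_nth)
  finally show ?thesis
    by (simp add: sum_negf)
qed

text \<open>Cayley's identity for almost principal minors in terms of Pfaffians, by strong induction
  on the length. For \<open>k = i\<close> it says that a principal minor is the square of a
  Pfaffian.\<close>

lemma minor_list_row_expansion:
  assumes re: "row_expansion a \<psi> S" and empty: "\<psi> {} = 1"
    and "distinct xs" "set xs \<subseteq> S" "k \<in> S - set xs" "i \<in> S - set xs"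
  shows "minor_list a (k # xs) (i # xs) =
      sgn_at k (set xs) * \<psi> (insert k (set xs)) * (sgn_at i (set xs) * \<psi> (insert i (set xs)))
      + \<psi> (set xs) * (if k = i then 0
          else sgn_at i (set xs) * sgn_at k (insert i (set xs)) * \<psi> (insert i (insert k (set xs))))"
  using assms(3-)
proof (induction "length xs" arbitrary: xs k i rule: less_induct)
  case less
  define X where "X = set xs"
  have X: "X \<subseteq> S" "k \<in> S" "k \<notin> X" "i \<in> S" "i \<notin> X" and finX: "finite X"
    using less.prems by (auto simp: X_def)
  have E: "(\<Sum>j\<in>Y. a i j * sgn_at j Y * \<psi> (Y - {j})) =
       (if i \<in> Y then 0 else sgn_at i Y * \<psi> (insert i Y))" if "i \<in> S" "Y \<subseteq> S" for i Y
    using re that unfolding row_expansion_def by blast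
  \<comment> \<open>The case \<open>k = i\<close> of the induction hypothesis, with the head of the
    list as common border.\<close>
  have prin: "minor_list a xs xs = (\<psi> X)\<^sup>2"
  proof (cases xs)
    case Nil
    then show ?thesis by (simp add: minor_list_def X_def empty)
  next
    case (Cons m ys)
    then have "minor_list a (m # ys) (m # ys) =
      sgn_at m (set ys) * \<psi> (insert m (set ys)) * (sgn_at m (set ys) * \<psi> (insert m (set ys)))"
      using less.hyps[of ys m m] less.prems by auto
    then show ?thesis
      by (simp add: Cons X_def power2_eq_square mult_ac)
  qed
  define \<phi> where "\<phi> = sgn_at i X * \<psi> (insert i X)"
  define R where "R = (if k = i then 0
          else sgn_at i X * sgn_at k (insert i X) * \<psi> (insert i (insert k X)))"
  \<comment> \<open>The induction hypothesis for the list without \<open>c\<close>, bordered by row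
    \<open>c\<close> and column \<open>i\<close>. Since \<open>c \<noteq> i\<close>, both terms of
    the formula are present.\<close>
  have "(\<Sum>p<length xs. a k (xs ! p) *
         minor_list a (xs ! p # remove_nth p xs) (i # remove_nth p xs))
      = (\<Sum>c\<in>X. a k c * (sgn_at c X * \<psi> X * (sgn_at i (X - {c}) * \<psi> (insert i (X - {c})))
            - \<psi> (X - {c}) * (sgn_at c X * \<phi>)))" (is "_ = (\<Sum>c\<in>X. ?f c)")
  proof -
    have "a k (xs ! p) * minor_list a (xs ! p # remove_nth p xs) (i # remove_nth p xs) = ?f (xs ! p)"
      if p: "p < length xs" for p
    proof -
      define c where "c = xs ! p"
      have c: "c \<in> X" and ci: "c \<noteq> i"
        using p X by (auto simp: c_def X_def)
      have s: "set (remove_nth p xs) = X - {c}"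
        using distinct_remove_nth[OF less.prems(1) p] by (simp add: X_def c_def)
      have "minor_list a (c # remove_nth p xs) (i # remove_nth p xs) =
        sgn_at c (X - {c}) * \<psi> (insert c (X - {c})) * (sgn_at i (X - {c}) * \<psi> (insert i (X - {c})))
      + \<psi> (X - {c}) * (if c = i then 0
          else sgn_at i (X - {c}) * sgn_at c (insert i (X - {c})) * \<psi> (insert i (insert c (X - {c}))))"
        unfolding s[symmetric]
        by (rule less.hyps) (use p less.prems X c in \<open>auto simp: length_remove_nth distinct_remove_nth c_def X_def\<close>)
      moreover have "insert c (X - {c}) = X" "sgn_at c (X - {c}) = sgn_at c X"
        using c by (auto simp: sgn_at_remove)
      ultimately have E1: "minor_list a (c # remove_nth p xs) (i # remove_nth p xs) =
        sgn_at c X * \<psi> X * (sgn_at i (X - {c}) * \<psi> (insert i (X - {c})))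
        + \<psi> (X - {c}) * ((sgn_at i (X - {c}) * sgn_at c (insert i (X - {c}))) * \<psi> (insert i X))"
        using ci by simp
      have E2: "sgn_at i (X - {c}) * sgn_at c (insert i (X - {c})) = - (sgn_at c X * sgn_at i X)"
        using c ci X by (auto simp: sgn_at_remove sgn_at_insert)
      show ?thesis
        unfolding c_def[symmetric] E1 E2 \<phi>_def by (simp add: algebra_simps)
    qed
    then have "(\<Sum>p<length xs. a k (xs ! p) *
         minor_list a (xs ! p # remove_nth p xs) (i # remove_nth p xs)) = (\<Sum>p<length xs. ?f (xs ! p))"
      by (intro sum.cong) auto
    also have "\<dots> = (\<Sum>c\<in>X. ?f c)"
    proof -
      have "bij_betw ((!) xs) {..<length xs} X"
        using less.prems by (intro bij_betw_nth) (auto simp: X_def)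
      then show ?thesis
        by (rule sum.reindex_bij_betw[where g = ?f])
    qed
    finally show ?thesis .
  qed
  also have "\<dots> = \<psi> X * (\<Sum>c\<in>X. a k c * sgn_at c X * (sgn_at i (X - {c}) * \<psi> (insert i (X - {c}))))
       - \<phi> * (\<Sum>c\<in>X. a k c * sgn_at c X * \<psi> (X - {c}))"
    by (simp add: sum_distrib_left sum_subtractf right_diff_distrib mult_ac)
  also have "(\<Sum>c\<in>X. a k c * sgn_at c X * \<psi> (X - {c})) = sgn_at k X * \<psi> (insert k X)"
    using E[of k X] X by simp
  also have "(\<Sum>c\<in>X. a k c * sgn_at c X * (sgn_at i (X - {c}) * \<psi> (insert i (X - {c}))))
      = a k i * \<psi> X - R"
  proof -
    \<comment> \<open>Row \<open>k\<close> is expanded on \<open>insert i X\<close>, and the term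
      \<open>j = i\<close> is split off.\<close>
    have "(\<Sum>j\<in>insert i X. a k j * sgn_at j (insert i X) * \<psi> (insert i X - {j}))
        = a k i * sgn_at i X * \<psi> X + (\<Sum>c\<in>X. a k c * sgn_at c (insert i X) * \<psi> (insert i (X - {c})))"
    proof -
      have "insert i X - {c} = insert i (X - {c})" if "c \<in> X" for c
        using that X by auto
      then show ?thesis
        using finX X by simp
    qed
    also have "(\<Sum>c\<in>X. a k c * sgn_at c (insert i X) * \<psi> (insert i (X - {c})))
        = - sgn_at i X * (\<Sum>c\<in>X. a k c * sgn_at c X * (sgn_at i (X - {c}) * \<psi> (insert i (X - {c}))))"
      unfolding sum_distrib_left
    proof (intro sum.cong refl)
      fix c assume c: "c \<in> X"
      have "sgn_at c (insert i X) = sgn_at i X * (sgn_at i X * sgn_at c (insert i X))"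
        by simp
      also have "\<dots> = - sgn_at i X * (sgn_at c X * sgn_at i (X - {c}))"
        using sgn_at_insert_remove_swap[OF X(5) c] by simp
      finally show "a k c * sgn_at c (insert i X) * \<psi> (insert i (X - {c}))
        = - sgn_at i X * (a k c * sgn_at c X * (sgn_at i (X - {c}) * \<psi> (insert i (X - {c}))))"
        by simp
    qed
    finally have "(if k = i then 0 else sgn_at k (insert i X) * \<psi> (insert k (insert i X)))
        = sgn_at i X * (a k i * \<psi> X
          - (\<Sum>c\<in>X. a k c * sgn_at c X * (sgn_at i (X - {c}) * \<psi> (insert i (X - {c})))))"
      using E[of k "insert i X"] X by (auto simp: algebra_simps)
    then have "sgn_at i X * (if k = i then 0 else sgn_at k (insert i X) * \<psi> (insert k (insert i X)))
        = a k i * \<psi> X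
          - (\<Sum>c\<in>X. a k c * sgn_at c X * (sgn_at i (X - {c}) * \<psi> (insert i (X - {c}))))"
      by simp
    moreover have "sgn_at i X * (if k = i then 0 else sgn_at k (insert i X) * \<psi> (insert k (insert i X))) = R"
      by (simp add: R_def insert_commute)
    ultimately show ?thesis
      by linarith
  qed
  finally have "minor_list a (k # xs) (i # xs) = a k i * (\<psi> X)\<^sup>2
      - (\<psi> X * (a k i * \<psi> X - R) - \<phi> * (sgn_at k X * \<psi> (insert k X)))"
    unfolding minor_list_border[of a k xs i] prin by (simp only:)
  then show ?case
    unfolding X_def[symmetric] R_def[symmetric] \<phi>_def
    by (simp add: power2_eq_square algebra_simps)
qed

lemma minor_list_principal:
  assumes "row_expansion a \<psi> S" "\<psi> {} = 1" "distinct xs" "set xs \<subseteq> S"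
  shows "minor_list a xs xs = (\<psi> (set xs))\<^sup>2"
proof (cases xs)
  case Nil
  then show ?thesis by (simp add: minor_list_def assms)
next
  case (Cons m ys)
  then have "minor_list a (m # ys) (m # ys) =
    sgn_at m (set ys) * \<psi> (insert m (set ys)) * (sgn_at m (set ys) * \<psi> (insert m (set ys)))"
    using minor_list_row_expansion[OF assms(1,2), of ys m m] assms(3,4) by auto
  then show ?thesis
    by (simp add: Cons power2_eq_square mult_ac)
qed

lemma pfaffian_empty: "pfaffian a n {} = 1"
  by (induction n) auto

text \<open>Entries outside the range are set to 0 so that skewness holds for all indices, as
  \<open>row_expansion_pfaffian\<close> demands.\<close>

lemma skew_entries:
  assumes A: "A \<in> carrier_mat n n" and skew: "transpose_mat A = - A"
  shows "(if i < n \<and> j < n then A $$ (i, j) else 0) = - (if j < n \<and> i < n then A $$ (j, i) else (0 :: real))"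
proof (cases "i < n \<and> j < n")
  case True
  have "transpose_mat A $$ (j, i) = (- A) $$ (j, i)"
    by (simp add: skew)
  then show ?thesis using A True by simp
qed auto

text \<open>\<open>pick S\<close> enumerates \<open>S\<close> without repetition, so
  \<open>submatrix A S S\<close> is the matrix behind a principal \<open>minor_list\<close>, and
  Cayley's identity applies.\<close>

lemma minor_weight_pfaffian:
  assumes A: "A \<in> carrier_mat n n" and skew: "transpose_mat A = - A" and S: "S \<subseteq> {0..<n}"
  shows "minor_weight A S =
    (pfaffian (\<lambda>i j. if i < n \<and> j < n then A $$ (i, j) else 0) n S)\<^sup>2"
proof -
  define a where "a = (\<lambda>i j. if i < n \<and> j < n then A $$ (i, j) else 0)"
  have "a i j = - a j i" for i j
    unfolding a_def by (rule skew_entries[OF A skew])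
  then have re: "row_expansion a (pfaffian a n) {0..<n}"
    by (rule row_expansion_pfaffian)
  define xs where "xs = map (pick S) [0..<card S]"
  have finS: "finite S"
    using S finite_subset by blast
  have inj: "inj_on (pick S) {0..<card S}"
  proof (rule linorder_inj_onI)
    fix x y assume "x < y" "x \<in> {0..<card S}" "y \<in> {0..<card S}"
    then show "pick S x \<noteq> pick S y"
      using pick_mono_le[of y S x] by auto
  qed auto
  have "pick S ` {0..<card S} \<subseteq> S"
    using pick_in_set_le by auto
  then have img: "pick S ` {0..<card S} = S"
    using finS inj by (intro card_subset_eq) (auto simp: card_image)
  have d: "distinct xs" and s: "set xs = S"
    using inj img by (auto simp: xs_def distinct_map)
  have "{i. i < n \<and> i \<in> S} = S"
    using S by auto
  then have "submatrix A S S = mat (card S) (card S) (\<lambda>(i, j). A $$ (pick S i, pick S j))"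
    using A by (simp add: submatrix_def)
  also have "\<dots> = mat (length xs) (length xs) (\<lambda>(p, q). a (xs ! p) (xs ! q))"
  proof (intro eq_matI)
    fix i j assume "i < dim_row (mat (length xs) (length xs) (\<lambda>(p, q). a (xs ! p) (xs ! q)))"
      "j < dim_col (mat (length xs) (length xs) (\<lambda>(p, q). a (xs ! p) (xs ! q)))"
    then have ij: "i < card S" "j < card S" by (simp_all add: xs_def)
    then have "pick S i < n" "pick S j < n"
      using img S by (auto simp: image_subset_iff dest: pick_in_set_le)
    then show "mat (card S) (card S) (\<lambda>(i, j). A $$ (pick S i, pick S j)) $$ (i, j) =
        mat (length xs) (length xs) (\<lambda>(p, q). a (xs ! p) (xs ! q)) $$ (i, j)"
      using ij by (simp add: xs_def a_def)
  qed (simp_all add: xs_def)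
  finally have "minor_weight A S = minor_list a xs xs"
    by (simp add: minor_weight_def minor_list_def)
  also have "\<dots> = (pfaffian a n S)\<^sup>2"
    using minor_list_principal[OF re pfaffian_empty d] s S by simp
  finally show ?thesis
    by (simp add: a_def)
qed

section \<open>Wick relations and the number operator\<close>

text \<open>The quadratic relations of pure spinors. Unlike \<open>row_expansion\<close> they
  mention no matrix and are homogeneous, so they survive conditioning a coordinate to be present
  (\<open>wick_pin\<close>); the induction for the entropy relies on this.\<close>

definition wick :: "nat set \<Rightarrow> (nat set \<Rightarrow> real) \<Rightarrow> bool" where
  "wick S \<psi> \<longleftrightarrow> (\<forall>Y\<subseteq>S. \<forall>Y'\<subseteq>S. (\<Sum>j | j \<in> S \<and> (j \<in> Y) \<noteq> (j \<in> Y').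
      sgn_at j Y * \<psi> (flip j Y) * (sgn_at j Y' * \<psi> (flip j Y'))) = 0)"

text \<open>The sums over \<open>Y - Y'\<close> and \<open>Y' - Y\<close> each become a bilinear
  form with matrix \<open>a\<close> in the removal amplitudes \<open>d\<close>; skewness makes the
  two cancel.\<close>

lemma wick_row_expansion:
  assumes re: "row_expansion a \<psi> S" and skew: "\<And>i j. a i j = - a j i" and fin: "finite S"
  shows "wick S \<psi>"
  unfolding wick_def
proof (intro allI impI)
  fix Y Y' assume Y: "Y \<subseteq> S" and Y': "Y' \<subseteq> S"
  have finY: "finite Y" "finite Y'"
    using Y Y' fin finite_subset by blast+
  define d where "d Y j = sgn_at j Y * \<psi> (Y - {j})" for Y j
  have half: "(\<Sum>j | j \<in> S \<and> j \<in> Y \<and> j \<notin> Y'.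
        sgn_at j Y * \<psi> (flip j Y) * (sgn_at j Y' * \<psi> (flip j Y')))
      = (\<Sum>j\<in>Y. \<Sum>k\<in>Y'. a j k * (d Y j * d Y' k))"
    if Y: "Y \<subseteq> S" and Y': "Y' \<subseteq> S" and finY: "finite Y" "finite Y'" for Y Y'
  proof -
    \<comment> \<open>Indices in \<open>Y \<inter> Y'\<close> may be added with value 0, which is
      also the value of the expansion with a repeated row.\<close>
    have "(\<Sum>j | j \<in> S \<and> j \<in> Y \<and> j \<notin> Y'.
        sgn_at j Y * \<psi> (flip j Y) * (sgn_at j Y' * \<psi> (flip j Y')))
        = (\<Sum>j\<in>Y. d Y j * (if j \<in> Y' then 0 else sgn_at j Y' * \<psi> (insert j Y')))"
      using Y finY
      by (intro sum.mono_neutral_cong_left) (auto simp: d_def flip_insert flip_remove)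
    also have "\<dots> = (\<Sum>j\<in>Y. d Y j * (\<Sum>k\<in>Y'. a j k * d Y' k))"
    proof (intro sum.cong refl)
      fix j assume "j \<in> Y"
      then have "(\<Sum>k\<in>Y'. a j k * sgn_at k Y' * \<psi> (Y' - {k})) =
          (if j \<in> Y' then 0 else sgn_at j Y' * \<psi> (insert j Y'))"
        using re Y Y' unfolding row_expansion_def by blast
      then show "d Y j * (if j \<in> Y' then 0 else sgn_at j Y' * \<psi> (insert j Y'))
          = d Y j * (\<Sum>k\<in>Y'. a j k * d Y' k)"
        by (simp add: d_def mult.assoc)
    qed
    finally show ?thesis
      by (simp add: sum_distrib_left mult_ac)
  qed
  have "{j. j \<in> S \<and> (j \<in> Y) \<noteq> (j \<in> Y')} =
      {j. j \<in> S \<and> j \<in> Y \<and> j \<notin> Y'} \<union> {j. j \<in> S \<and> j \<in> Y' \<and> j \<notin> Y}"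
    by auto
  then have "(\<Sum>j | j \<in> S \<and> (j \<in> Y) \<noteq> (j \<in> Y').
      sgn_at j Y * \<psi> (flip j Y) * (sgn_at j Y' * \<psi> (flip j Y')))
    = (\<Sum>j | j \<in> S \<and> j \<in> Y \<and> j \<notin> Y'. sgn_at j Y * \<psi> (flip j Y) * (sgn_at j Y' * \<psi> (flip j Y')))
    + (\<Sum>j | j \<in> S \<and> j \<in> Y' \<and> j \<notin> Y. sgn_at j Y * \<psi> (flip j Y) * (sgn_at j Y' * \<psi> (flip j Y')))"
    using fin by (simp only:) (rule sum.union_disjoint, auto)
  also have "(\<Sum>j | j \<in> S \<and> j \<in> Y' \<and> j \<notin> Y.
        sgn_at j Y * \<psi> (flip j Y) * (sgn_at j Y' * \<psi> (flip j Y')))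
      = (\<Sum>j\<in>Y'. \<Sum>k\<in>Y. a j k * (d Y' j * d Y k))"
    using half[OF Y' Y finY(2,1)] by (simp add: mult.commute)
  also have "\<dots> = (\<Sum>k\<in>Y. \<Sum>j\<in>Y'. - (a k j * (d Y k * d Y' j)))"
    by (subst sum.swap, intro sum.cong refl) (subst skew, simp)
  also have "\<dots> = - (\<Sum>j\<in>Y. \<Sum>k\<in>Y'. a j k * (d Y j * d Y' k))"
    by (simp add: sum_negf)
  finally show "(\<Sum>j | j \<in> S \<and> (j \<in> Y) \<noteq> (j \<in> Y').
      sgn_at j Y * \<psi> (flip j Y) * (sgn_at j Y' * \<psi> (flip j Y'))) = 0"
    using half[OF Y Y' finY] by simp
qed

text \<open>Pinning \<open>e\<close> leaves the difference of \<open>Y\<close> and \<open>Y'\<close>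
  unchanged, and a sign caused by inserting \<open>e\<close> occurs once for \<open>Y\<close> and
  once for \<open>Y'\<close>, hence cancels.\<close>

lemma wick_pin:
  assumes "wick S \<psi>" "e \<in> S"
  shows "wick (S - {e}) \<psi>" "wick (S - {e}) (\<lambda>X. \<psi> (insert e X))"
proof -
  show "wick (S - {e}) \<psi>"
    unfolding wick_def
  proof (intro allI impI)
    fix Y Y' assume Y: "Y \<subseteq> S - {e}" "Y' \<subseteq> S - {e}"
    then have "{j. j \<in> S - {e} \<and> (j \<in> Y) \<noteq> (j \<in> Y')} = {j. j \<in> S \<and> (j \<in> Y) \<noteq> (j \<in> Y')}"
      by auto
    moreover have "(\<Sum>j | j \<in> S \<and> (j \<in> Y) \<noteq> (j \<in> Y').
      sgn_at j Y * \<psi> (flip j Y) * (sgn_at j Y' * \<psi> (flip j Y'))) = 0"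
      using assms(1) Y unfolding wick_def by blast
    ultimately show "(\<Sum>j | j \<in> S - {e} \<and> (j \<in> Y) \<noteq> (j \<in> Y').
      sgn_at j Y * \<psi> (flip j Y) * (sgn_at j Y' * \<psi> (flip j Y'))) = 0"
      by (simp only:)
  qed
  show "wick (S - {e}) (\<lambda>X. \<psi> (insert e X))"
    unfolding wick_def
  proof (intro allI impI)
    fix Y Y' assume Y: "Y \<subseteq> S - {e}" "Y' \<subseteq> S - {e}"
    have "insert e Y \<subseteq> S" "insert e Y' \<subseteq> S" using Y assms(2) by auto
    then have "(\<Sum>j | j \<in> S \<and> (j \<in> insert e Y) \<noteq> (j \<in> insert e Y').
      sgn_at j (insert e Y) * \<psi> (flip j (insert e Y)) *
      (sgn_at j (insert e Y') * \<psi> (flip j (insert e Y')))) = 0"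
      using assms(1) unfolding wick_def by blast
    moreover have "(\<Sum>j | j \<in> S - {e} \<and> (j \<in> Y) \<noteq> (j \<in> Y').
      sgn_at j Y * \<psi> (insert e (flip j Y)) * (sgn_at j Y' * \<psi> (insert e (flip j Y'))))
      = (\<Sum>j | j \<in> S \<and> (j \<in> insert e Y) \<noteq> (j \<in> insert e Y').
      sgn_at j (insert e Y) * \<psi> (flip j (insert e Y)) *
      (sgn_at j (insert e Y') * \<psi> (flip j (insert e Y'))))"
    proof (intro sum.cong)
      fix j assume j: "j \<in> {j. j \<in> S \<and> (j \<in> insert e Y) \<noteq> (j \<in> insert e Y')}"
      then have "j \<noteq> e" by auto
      then have "flip j (insert e Y) = insert e (flip j Y)" "flip j (insert e Y') = insert e (flip j Y')"
        by (auto simp: set_eq_iff)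
      moreover have "e \<notin> Y" "e \<notin> Y'" using Y by auto
      ultimately show "sgn_at j Y * \<psi> (insert e (flip j Y)) * (sgn_at j Y' * \<psi> (insert e (flip j Y')))
        = sgn_at j (insert e Y) * \<psi> (flip j (insert e Y)) *
      (sgn_at j (insert e Y') * \<psi> (flip j (insert e Y')))"
        by (simp add: sgn_at_insert)
    qed (use Y in auto)
    ultimately show "(\<Sum>j | j \<in> S - {e} \<and> (j \<in> Y) \<noteq> (j \<in> Y').
      sgn_at j Y * \<psi> (insert e (flip j Y)) * (sgn_at j Y' * \<psi> (insert e (flip j Y')))) = 0"
      by simp
  qed
qed

section \<open>Flip amplitudes as vectors of an isotropic space\<close>

definition amp :: "(nat set \<Rightarrow> real) \<Rightarrow> nat \<Rightarrow> nat set \<Rightarrow> real" where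
  "amp \<psi> j Y = sgn_at j Y * \<psi> (flip j Y)"

lemma amp_mult_self: "amp \<psi> j Y * amp \<phi> j Y = \<psi> (flip j Y) * \<phi> (flip j Y)"
  by (simp add: amp_def mult.left_commute mult.assoc)

text \<open>Anticommutation of distinct flips: flipping both coordinates exchanges the two values of
  \<open>\<psi>\<close>, and exactly one of the two signs changes.\<close>

lemma amp_swap:
  assumes "j \<noteq> k"
  shows "amp \<psi> j (flip j (flip k V)) * amp \<psi> k (flip j (flip k V)) = - (amp \<psi> j V * amp \<psi> k V)"
proof -
  have "flip k (flip j (flip k V)) = flip j V"
    by (simp add: flip_commute[of k j])
  moreover have "sgn_at j (flip j (flip k V)) * sgn_at k (flip j (flip k V)) = - (sgn_at j V * sgn_at k V)"
    using assms by (auto simp: sgn_at_flip)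
  moreover have "amp \<psi> j (flip j (flip k V)) * amp \<psi> k (flip j (flip k V)) =
     (sgn_at j (flip j (flip k V)) * sgn_at k (flip j (flip k V)))
       * (\<psi> (flip j (flip j (flip k V))) * \<psi> (flip k (flip j (flip k V))))"
    by (simp only: amp_def mult_ac)
  ultimately show ?thesis
    by (simp add: amp_def)
qed

lemma sum_Pow_flip: "k \<in> S \<Longrightarrow> (\<Sum>V\<in>Pow S. f (flip k V)) = (\<Sum>V\<in>Pow S. f V)"
  by (rule sum.reindex_bij_witness[of _ "flip k" "flip k"]) (auto simp: flip_subset)

lemma sum_Pow_amp_antisym:
  assumes "j \<in> S" "k \<in> S" "j \<noteq> k" and P: "\<And>V. P' V = P (flip j (flip k V))"
  shows "(\<Sum>V\<in>Pow S. P V * (amp \<psi> j V * amp \<psi> k V)) =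
      - (\<Sum>V\<in>Pow S. P' V * (amp \<psi> j V * amp \<psi> k V))"
proof -
  have "(\<Sum>V\<in>Pow S. P V * (amp \<psi> j V * amp \<psi> k V))
      = (\<Sum>V\<in>Pow S. P (flip j (flip k V)) *
          (amp \<psi> j (flip j (flip k V)) * amp \<psi> k (flip j (flip k V))))"
    using sum_Pow_flip[OF assms(2), of "\<lambda>V. P (flip j V) * (amp \<psi> j (flip j V) * amp \<psi> k (flip j V))"]
      sum_Pow_flip[OF assms(1), of "\<lambda>V. P V * (amp \<psi> j V * amp \<psi> k V)"] by simp
  also have "\<dots> = - (\<Sum>V\<in>Pow S. P' V * (amp \<psi> j V * amp \<psi> k V))"
    by (simp add: amp_swap[OF assms(3)] P sum_negf)
  finally show ?thesis .
qed

lemma wick_amp: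
  assumes "wick S \<psi>" "finite S" "Y \<subseteq> S" "V \<subseteq> S"
  shows "(\<Sum>j\<in>S. of_bool ((j \<in> V) \<noteq> (j \<in> Y)) * (amp \<psi> j V * amp \<psi> j Y)) = 0"
proof -
  have "(\<Sum>j\<in>S. of_bool ((j \<in> V) \<noteq> (j \<in> Y)) * (amp \<psi> j V * amp \<psi> j Y))
      = (\<Sum>j | j \<in> S \<and> (j \<in> V) \<noteq> (j \<in> Y). amp \<psi> j V * amp \<psi> j Y)"
    using assms(2) by (intro sum.mono_neutral_cong_right) auto
  also have "\<dots> = 0"
    using assms(1,3,4) unfolding wick_def amp_def by blast
  finally show ?thesis .
qed

text \<open>Attach to \<open>V\<close> the vector with entry \<open>amp \<psi> j V\<close> in slot
  \<open>(j, j \<in> V)\<close> of a space with two slots per coordinate. This is its Euclidean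
  inner product with the vector holding \<open>u j\<close> in slot \<open>(j, j \<in> Y)\<close>.
  The Wick relations say that the vectors of all \<open>V\<close> are mutually isotropic for the
  form that pairs the two slots of each coordinate.\<close>

definition agree_amp :: "nat set \<Rightarrow> (nat set \<Rightarrow> real) \<Rightarrow> nat set \<Rightarrow> nat set \<Rightarrow> (nat \<Rightarrow> real) \<Rightarrow> real" where
  "agree_amp S \<psi> Y V u = (\<Sum>j\<in>S. of_bool ((j \<in> V) = (j \<in> Y)) * (amp \<psi> j V * u j))"

lemma sum_mult_delta:
  "finite S \<Longrightarrow> k \<in> S \<Longrightarrow> (\<Sum>j\<in>S. f j * (if j = k then c else 0)) = f k * (c :: real)"
  by (simp add: if_distrib[of "(*) _"] cong: if_cong)

text \<open>Summing the rank-one operators of the vectors described at \<open>agree_amp\<close>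
  gives an operator that acts on the vector of \<open>Y\<close> as the total mass. Indeed, adding
  its counterpart for disagreeing slots yields the total mass times the identity, by
  anticommutation, and the counterpart kills the vector of \<open>Y\<close> by the Wick
  relations.\<close>

lemma wick_reproducing:
  assumes wick: "wick S \<psi>" and fin: "finite S" and Y: "Y \<subseteq> S" and k: "k \<in> S"
  shows "(\<Sum>V\<in>Pow S. agree_amp S \<psi> Y V (\<lambda>j. amp \<psi> j Y) * (of_bool ((k \<in> V) = (k \<in> Y)) * amp \<psi> k V))
    = (\<Sum>V\<in>Pow S. (\<psi> V)\<^sup>2) * amp \<psi> k Y"
proof -
  define T where "T j = (\<Sum>V\<in>Pow S. (of_bool ((k \<in> V) = (k \<in> Y)) * of_bool ((j \<in> V) = (j \<in> Y)))
      * (amp \<psi> j V * amp \<psi> k V))" for j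
  define T' where "T' j = (\<Sum>V\<in>Pow S. (of_bool ((k \<in> V) \<noteq> (k \<in> Y)) * of_bool ((j \<in> V) \<noteq> (j \<in> Y)))
      * (amp \<psi> j V * amp \<psi> k V))" for j
  define N where "N = (\<Sum>V\<in>Pow S. (\<psi> V)\<^sup>2)"
  \<comment> \<open>For \<open>j \<noteq> k\<close>, flipping both coordinates turns agreement with
    \<open>Y\<close> into disagreement and reverses the sign of the amplitudes.\<close>
  have TT': "T j = (if j = k then N else 0) - T' j" if j: "j \<in> S" for j
  proof (cases "j = k")
    case True
    have "T k + T' k = (\<Sum>V\<in>Pow S. amp \<psi> k V * amp \<psi> k V)"
      unfolding T_def T'_def sum.distrib[symmetric] by (intro sum.cong) auto
    also have "\<dots> = N"
      unfolding amp_mult_self N_def power2_eq_square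
      using sum_Pow_flip[OF k, of "\<lambda>V. \<psi> V * \<psi> V"] by simp
    finally show ?thesis using True by simp
  next
    case False
    then have "T j = - T' j"
      unfolding T_def T'_def by (intro sum_Pow_amp_antisym j k) auto
    then show ?thesis using False by simp
  qed
  have "(\<Sum>V\<in>Pow S. agree_amp S \<psi> Y V (\<lambda>j. amp \<psi> j Y) * (of_bool ((k \<in> V) = (k \<in> Y)) * amp \<psi> k V))
      = (\<Sum>V\<in>Pow S. \<Sum>j\<in>S. amp \<psi> j Y * ((of_bool ((k \<in> V) = (k \<in> Y)) * of_bool ((j \<in> V) = (j \<in> Y)))
      * (amp \<psi> j V * amp \<psi> k V)))"
    unfolding agree_amp_def sum_distrib_right by (intro sum.cong refl) (simp only: mult_ac)
  also have "\<dots> = (\<Sum>j\<in>S. amp \<psi> j Y * T j)"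
    unfolding T_def sum_distrib_left by (rule sum.swap)
  also have "\<dots> = (\<Sum>j\<in>S. amp \<psi> j Y * (if j = k then N else 0)) - (\<Sum>j\<in>S. amp \<psi> j Y * T' j)"
    unfolding sum_subtractf[symmetric] right_diff_distrib[symmetric]
    by (intro sum.cong refl) (simp add: TT')
  also have "(\<Sum>j\<in>S. amp \<psi> j Y * T' j) = (\<Sum>V\<in>Pow S. of_bool ((k \<in> V) \<noteq> (k \<in> Y)) * amp \<psi> k V *
      (\<Sum>j\<in>S. of_bool ((j \<in> V) \<noteq> (j \<in> Y)) * (amp \<psi> j V * amp \<psi> j Y)))"
    unfolding T'_def sum_distrib_left
    by (subst sum.swap, intro sum.cong refl) (simp only: mult_ac)
  also have "\<dots> = 0"
    using wick_amp[OF wick fin Y] by (intro sum.neutral) auto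
  finally show ?thesis
    using sum_mult_delta[OF fin k, of "\<lambda>j. amp \<psi> j Y" N] by (simp add: N_def)
qed

text \<open>The projection of \<open>u\<close> onto one vector of the isotropic space is no longer
  than its projection onto the whole space. The proof is Cauchy-Schwarz over \<open>V\<close> with
  coefficients \<open>b V\<close>, whose sum of squares the reproducing identity evaluates
  too.\<close>

lemma wick_projection_bound:
  assumes wick: "wick S \<psi>" and fin: "finite S" and Y: "Y \<subseteq> S"
  shows "(\<Sum>V\<in>Pow S. (\<psi> V)\<^sup>2) * (\<Sum>j\<in>S. amp \<psi> j Y * u j)\<^sup>2
    \<le> (\<Sum>j\<in>S. (amp \<psi> j Y)\<^sup>2) * (\<Sum>V\<in>Pow S. (agree_amp S \<psi> Y V u)\<^sup>2)"
proof -
  define N where "N = (\<Sum>V\<in>Pow S. (\<psi> V)\<^sup>2)"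
  define b where "b V = agree_amp S \<psi> Y V (\<lambda>j. amp \<psi> j Y)" for V
  have inner: "(\<Sum>V\<in>Pow S. b V * agree_amp S \<psi> Y V u) = N * (\<Sum>k\<in>S. amp \<psi> k Y * u k)" for u
  proof -
    have "(\<Sum>V\<in>Pow S. b V * agree_amp S \<psi> Y V u)
        = (\<Sum>V\<in>Pow S. \<Sum>k\<in>S. u k * (b V * (of_bool ((k \<in> V) = (k \<in> Y)) * amp \<psi> k V)))"
      unfolding agree_amp_def sum_distrib_left by (intro sum.cong refl) (simp only: mult_ac)
    also have "\<dots> = (\<Sum>k\<in>S. u k * (\<Sum>V\<in>Pow S. b V * (of_bool ((k \<in> V) = (k \<in> Y)) * amp \<psi> k V)))"
      unfolding sum_distrib_left by (rule sum.swap)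
    also have "\<dots> = (\<Sum>k\<in>S. u k * (N * amp \<psi> k Y))"
      unfolding b_def N_def using wick_reproducing[OF wick fin Y] by simp
    finally show ?thesis
      by (simp add: sum_distrib_left mult_ac)
  qed
  have N0: "N \<ge> 0"
    unfolding N_def by (intro sum_nonneg) auto
  have "(N * (\<Sum>k\<in>S. amp \<psi> k Y * u k))\<^sup>2 \<le> (\<Sum>V\<in>Pow S. (b V)\<^sup>2) * (\<Sum>V\<in>Pow S. (agree_amp S \<psi> Y V u)\<^sup>2)"
    unfolding inner[symmetric] by (rule Cauchy_Schwarz_ineq_sum)
  also have "(\<Sum>V\<in>Pow S. (b V)\<^sup>2) = N * (\<Sum>k\<in>S. (amp \<psi> k Y)\<^sup>2)"
    using inner[of "\<lambda>j. amp \<psi> j Y"] by (simp add: b_def power2_eq_square)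
  finally have *: "N * (N * (\<Sum>k\<in>S. amp \<psi> k Y * u k)\<^sup>2)
      \<le> N * ((\<Sum>k\<in>S. (amp \<psi> k Y)\<^sup>2) * (\<Sum>V\<in>Pow S. (agree_amp S \<psi> Y V u)\<^sup>2))"
    by (simp add: power_mult_distrib power2_eq_square mult_ac)
  show ?thesis
  proof (cases "N = 0")
    case True
    then show ?thesis
      unfolding N_def[symmetric] by (auto intro!: mult_nonneg_nonneg sum_nonneg)
  next
    case False
    then show ?thesis
      using * N0 unfolding N_def[symmetric] by simp
  qed
qed

section \<open>Covariance bounds and the lower bound for local variances\<close>

definition side_mass :: "nat set \<Rightarrow> (nat set \<Rightarrow> real) \<Rightarrow> nat \<Rightarrow> bool \<Rightarrow> real" where
  "side_mass S w j b = (\<Sum>V\<in>Pow S. of_bool ((j \<in> V) = b) * w V)"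

lemma side_mass_nonneg: "(\<And>V. w V \<ge> 0) \<Longrightarrow> side_mass S w j b \<ge> 0"
  unfolding side_mass_def by (intro sum_nonneg) auto

lemma side_mass_total: "side_mass S w j True + side_mass S w j False = (\<Sum>V\<in>Pow S. w V)"
  unfolding side_mass_def sum.distrib[symmetric] by (intro sum.cong) auto

lemma sum_bool: "(\<Sum>b\<in>(UNIV :: bool set). f b) = f True + (f False :: real)"
  by (simp add: UNIV_bool add.commute)

text \<open>The entry at slots \<open>(j, b)\<close> and \<open>(k, c)\<close> of the sum over
  \<open>V\<close> of the rank-one matrices of the vectors described at \<open>agree_amp\<close>.
  Its diagonal entries are side masses by \<open>side_mass_amp\<close>.\<close>

definition cross_amp :: "nat set \<Rightarrow> (nat set \<Rightarrow> real) \<Rightarrow> nat \<Rightarrow> bool \<Rightarrow> nat \<Rightarrow> bool \<Rightarrow> real" where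
  "cross_amp S \<psi> j b k c =
     (\<Sum>V\<in>Pow S. of_bool ((j \<in> V) = b) * of_bool ((k \<in> V) = c) * (amp \<psi> j V * amp \<psi> k V))"

lemma side_mass_amp:
  assumes "k \<in> S"
  shows "(\<Sum>V\<in>Pow S. of_bool ((j \<in> V) = b) * (amp \<psi> k V)\<^sup>2)
    = side_mass S (\<lambda>V. (\<psi> V)\<^sup>2) j (if k = j then \<not> b else b)"
proof -
  have "(\<Sum>V\<in>Pow S. of_bool ((j \<in> V) = b) * (amp \<psi> k V)\<^sup>2)
      = (\<Sum>V\<in>Pow S. of_bool ((j \<in> flip k V) = (if k = j then \<not> b else b)) * (\<psi> (flip k V))\<^sup>2)"
    by (intro sum.cong refl) (auto simp: power2_eq_square amp_mult_self)
  also have "\<dots> = side_mass S (\<lambda>V. (\<psi> V)\<^sup>2) j (if k = j then \<not> b else b)"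
    unfolding side_mass_def
    using sum_Pow_flip[OF assms, of "\<lambda>V. of_bool ((j \<in> V) = (if k = j then \<not> b else b)) * (\<psi> V)\<^sup>2"]
    by simp
  finally show ?thesis .
qed

text \<open>The canonical anticommutation relations in coordinates: the squared norms of
  \<open>\<Sum>\<^sub>k r\<^sub>k \<gamma>\<^sub>k \<psi>\<close> and of its adjoint counterpart add up to \<open>\<bar>r\<bar>\<^sup>2 \<bar>\<psi>\<bar>\<^sup>2\<close>.\<close>

lemma amp_combination_bound:
  assumes fin: "finite S"
  shows "(\<Sum>V\<in>Pow S. of_bool ((j \<in> V) = b) * (\<Sum>k\<in>S - {j}. r k (k \<in> V) * amp \<psi> k V)\<^sup>2)
    \<le> (\<Sum>k\<in>S - {j}. \<Sum>c\<in>UNIV. (r k c)\<^sup>2) * side_mass S (\<lambda>V. (\<psi> V)\<^sup>2) j b"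
proof -
  define h where "h V = (\<Sum>k\<in>S - {j}. r k (k \<in> V) * amp \<psi> k V)" for V
  define h' where "h' V = (\<Sum>k\<in>S - {j}. r k (k \<notin> V) * amp \<psi> k V)" for V
  define P where "P k l V = of_bool ((j \<in> V) = b) *
      (r k (k \<in> V) * r l (l \<in> V) + r k (k \<notin> V) * r l (l \<notin> V))" for k l V
  define Q where "Q k l = (\<Sum>V\<in>Pow S. P k l V * (amp \<psi> k V * amp \<psi> l V))" for k l
  have Q_off: "Q k l = 0" if kl: "k \<in> S - {j}" "l \<in> S - {j}" "k \<noteq> l" for k l
  proof -
    \<comment> \<open>Thanks to the summand from \<open>h'\<close>, the weight \<open>P k l\<close>
      is invariant under flipping both \<open>k\<close> and \<open>l\<close>, while the product of
      amplitudes changes sign.\<close>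
    have "Q k l = - Q k l"
      unfolding Q_def using kl by (intro sum_Pow_amp_antisym) (auto simp: P_def)
    then show ?thesis by simp
  qed
  have Q_diag: "Q k k = (\<Sum>c\<in>UNIV. (r k c)\<^sup>2) * side_mass S (\<lambda>V. (\<psi> V)\<^sup>2) j b"
    if k: "k \<in> S - {j}" for k
  proof -
    have "Q k k = (\<Sum>V\<in>Pow S. (\<Sum>c\<in>UNIV. (r k c)\<^sup>2) * (of_bool ((j \<in> V) = b) * (amp \<psi> k V)\<^sup>2))"
      unfolding Q_def
    proof (intro sum.cong refl)
      fix V
      show "P k k V * (amp \<psi> k V * amp \<psi> k V) =
          (\<Sum>c\<in>UNIV. (r k c)\<^sup>2) * (of_bool ((j \<in> V) = b) * (amp \<psi> k V)\<^sup>2)"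
        by (cases "k \<in> V") (simp_all add: P_def sum_bool power2_eq_square algebra_simps)
    qed
    then show ?thesis
      using side_mass_amp[of k S j b \<psi>] k by (simp flip: sum_distrib_left)
  qed
  have "(\<Sum>V\<in>Pow S. of_bool ((j \<in> V) = b) * (h V)\<^sup>2)
      \<le> (\<Sum>V\<in>Pow S. of_bool ((j \<in> V) = b) * ((h V)\<^sup>2 + (h' V)\<^sup>2))"
    by (intro sum_mono mult_left_mono) auto
  also have "\<dots> = (\<Sum>V\<in>Pow S. \<Sum>k\<in>S - {j}. \<Sum>l\<in>S - {j}. P k l V * (amp \<psi> k V * amp \<psi> l V))"
  proof (intro sum.cong refl)
    fix V
    have "(h V)\<^sup>2 + (h' V)\<^sup>2 = (\<Sum>k\<in>S - {j}. \<Sum>l\<in>S - {j}.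
        (r k (k \<in> V) * r l (l \<in> V) + r k (k \<notin> V) * r l (l \<notin> V)) * (amp \<psi> k V * amp \<psi> l V))"
      unfolding h_def h'_def power2_eq_square sum_product sum.distrib[symmetric]
      by (intro sum.cong refl) (simp add: algebra_simps)
    then show "of_bool ((j \<in> V) = b) * ((h V)\<^sup>2 + (h' V)\<^sup>2)
        = (\<Sum>k\<in>S - {j}. \<Sum>l\<in>S - {j}. P k l V * (amp \<psi> k V * amp \<psi> l V))"
      by (simp add: P_def sum_distrib_left mult.assoc)
  qed
  also have "\<dots> = (\<Sum>k\<in>S - {j}. \<Sum>l\<in>S - {j}. Q k l)"
    unfolding Q_def by (subst sum.swap, intro sum.cong refl, rule sum.swap)
  also have "\<dots> = (\<Sum>k\<in>S - {j}. Q k k)"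
  proof (intro sum.cong refl)
    fix k assume k: "k \<in> S - {j}"
    have "(\<Sum>l\<in>S - {j}. Q k l) = Q k k + (\<Sum>l\<in>S - {j} - {k}. Q k l)"
      using fin k by (intro sum.remove) auto
    also have "(\<Sum>l\<in>S - {j} - {k}. Q k l) = 0"
      using k by (intro sum.neutral ballI Q_off) auto
    finally show "(\<Sum>l\<in>S - {j}. Q k l) = Q k k" by simp
  qed
  also have "\<dots> = (\<Sum>k\<in>S - {j}. \<Sum>c\<in>UNIV. (r k c)\<^sup>2) * side_mass S (\<lambda>V. (\<psi> V)\<^sup>2) j b"
    unfolding sum_distrib_right[of "\<lambda>k. \<Sum>c\<in>UNIV. (r k c)\<^sup>2"] by (intro sum.cong refl Q_diag)
  finally show ?thesis
    unfolding h_def .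
qed

lemma of_bool_square: "(of_bool P :: real)\<^sup>2 = of_bool P"
  by (cases P) auto

text \<open>Duality: \<open>cross_amp\<close> itself is taken as the coefficients \<open>r\<close>,
  so that the sum of squares \<open>R\<close> is an inner product of \<open>amp \<psi> j\<close>
  with \<open>h\<close> on one side of \<open>j\<close>. Cauchy-Schwarz and
  \<open>amp_combination_bound\<close> give \<open>R * R \<le> R * (M True * M False)\<close>; the
  opposite side appears because \<open>amp \<psi> j\<close> evaluates \<open>\<psi>\<close> at the
  flipped set.\<close>

lemma cross_amp_bound:
  assumes fin: "finite S" and j: "j \<in> S"
  shows "(\<Sum>k\<in>S - {j}. \<Sum>c\<in>UNIV. (cross_amp S \<psi> j b k c)\<^sup>2)
    \<le> side_mass S (\<lambda>V. (\<psi> V)\<^sup>2) j True * side_mass S (\<lambda>V. (\<psi> V)\<^sup>2) j False"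
proof -
  define r where "r = cross_amp S \<psi> j b"
  define R where "R = (\<Sum>k\<in>S - {j}. \<Sum>c\<in>UNIV. (r k c)\<^sup>2)"
  define h where "h V = (\<Sum>k\<in>S - {j}. r k (k \<in> V) * amp \<psi> k V)" for V
  define M where "M b = side_mass S (\<lambda>V. (\<psi> V)\<^sup>2) j b" for b
  have R0: "R \<ge> 0"
    unfolding R_def by (intro sum_nonneg) auto
  have M0: "M b \<ge> 0" for b
    unfolding M_def by (intro side_mass_nonneg) auto
  have "R = (\<Sum>k\<in>S - {j}. \<Sum>c\<in>UNIV. \<Sum>V\<in>Pow S.
      of_bool ((k \<in> V) = c) * (r k c * (of_bool ((j \<in> V) = b) * amp \<psi> j V) * amp \<psi> k V))"
    unfolding R_def power2_eq_square
    by (subst (2) r_def) (simp add: cross_amp_def sum_distrib_left mult_ac)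
  also have "\<dots> = (\<Sum>k\<in>S - {j}. \<Sum>V\<in>Pow S.
      r k (k \<in> V) * (of_bool ((j \<in> V) = b) * amp \<psi> j V) * amp \<psi> k V)"
    unfolding sum_bool sum.distrib[symmetric] by (intro sum.cong refl) auto
  also have "\<dots> = (\<Sum>V\<in>Pow S. (of_bool ((j \<in> V) = b) * amp \<psi> j V) * (of_bool ((j \<in> V) = b) * h V))"
    by (subst sum.swap) (auto simp: h_def sum_distrib_left mult_ac intro!: sum.cong)
  finally have "R\<^sup>2 \<le> (\<Sum>V\<in>Pow S. (of_bool ((j \<in> V) = b) * amp \<psi> j V)\<^sup>2)
      * (\<Sum>V\<in>Pow S. (of_bool ((j \<in> V) = b) * h V)\<^sup>2)"
    using Cauchy_Schwarz_ineq_sum by metis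
  also have "(\<Sum>V\<in>Pow S. (of_bool ((j \<in> V) = b) * amp \<psi> j V)\<^sup>2) = M (\<not> b)"
    using side_mass_amp[OF j, of j b \<psi>] by (simp add: power_mult_distrib M_def of_bool_square)
  also have "(\<Sum>V\<in>Pow S. (of_bool ((j \<in> V) = b) * h V)\<^sup>2)
      = (\<Sum>V\<in>Pow S. of_bool ((j \<in> V) = b) * (h V)\<^sup>2)"
    by (simp add: power_mult_distrib of_bool_square)
  also have "M (\<not> b) * \<dots> \<le> M (\<not> b) * (R * M b)"
    unfolding h_def R_def M_def[of b] by (intro mult_left_mono amp_combination_bound fin M0)
  finally have "R * R \<le> R * (M True * M False)"
    by (cases b) (simp_all add: power2_eq_square mult_ac)
  then have "R \<le> M True * M False"
    using R0 M0[of True] M0[of False] by (cases "R = 0") auto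
  then show ?thesis
    by (simp add: R_def M_def r_def)
qed

text \<open>Total weight times the variance of \<open>f\<close> over the flips of \<open>Y\<close>
  along \<open>J\<close>. For total weight 0 the quotient is 0 by convention, and for nonnegative
  \<open>w\<close> so is the whole expression.\<close>

definition local_var :: "nat set \<Rightarrow> (nat set \<Rightarrow> real) \<Rightarrow> (nat set \<Rightarrow> real) \<Rightarrow> nat set \<Rightarrow> real" where
  "local_var J w f Y = (\<Sum>j\<in>J. w (flip j Y) * (f (flip j Y))\<^sup>2)
     - (\<Sum>j\<in>J. w (flip j Y) * f (flip j Y))\<^sup>2 / (\<Sum>j\<in>J. w (flip j Y))"

text \<open>The trace of the product of the two matrices described at \<open>cross_amp\<close>, one
  for \<open>\<psi>\<close> and one for \<open>\<phi>\<close>, separated into equal and distinct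
  coordinates.\<close>

lemma sum_agree_amp_square:
  assumes fin: "finite S"
  shows "(\<Sum>Y\<in>Pow S. \<Sum>V\<in>Pow S. (agree_amp S \<psi> Y V (\<lambda>j. amp \<phi> j Y))\<^sup>2)
    = (\<Sum>j\<in>S. (\<Sum>b\<in>UNIV. side_mass S (\<lambda>V. (\<psi> V)\<^sup>2) j b * side_mass S (\<lambda>V. (\<phi> V)\<^sup>2) j b)
        + (\<Sum>b\<in>UNIV. \<Sum>k\<in>S - {j}. \<Sum>c\<in>UNIV. cross_amp S \<psi> j b k c * cross_amp S \<phi> j b k c))"
proof -
  define F where "F j k V Y = of_bool ((j \<in> V) = (j \<in> Y)) * of_bool ((k \<in> V) = (k \<in> Y))
      * (amp \<psi> j V * amp \<psi> k V) * (amp \<phi> j Y * amp \<phi> k Y)" for j k V Y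
  have "(\<Sum>Y\<in>Pow S. \<Sum>V\<in>Pow S. (agree_amp S \<psi> Y V (\<lambda>j. amp \<phi> j Y))\<^sup>2)
      = (\<Sum>Y\<in>Pow S. \<Sum>V\<in>Pow S. \<Sum>j\<in>S. \<Sum>k\<in>S. F j k V Y)"
    unfolding agree_amp_def power2_eq_square sum_product F_def
    by (intro sum.cong refl) (simp only: mult_ac)
  also have "\<dots> = (\<Sum>Y\<in>Pow S. \<Sum>j\<in>S. \<Sum>V\<in>Pow S. \<Sum>k\<in>S. F j k V Y)"
    by (intro sum.cong refl sum.swap)
  also have "\<dots> = (\<Sum>j\<in>S. \<Sum>Y\<in>Pow S. \<Sum>V\<in>Pow S. \<Sum>k\<in>S. F j k V Y)"
    by (rule sum.swap)
  also have "\<dots> = (\<Sum>j\<in>S. \<Sum>Y\<in>Pow S. \<Sum>k\<in>S. \<Sum>V\<in>Pow S. F j k V Y)"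
    by (intro sum.cong refl sum.swap)
  also have "\<dots> = (\<Sum>j\<in>S. \<Sum>k\<in>S. \<Sum>Y\<in>Pow S. \<Sum>V\<in>Pow S. F j k V Y)"
    by (intro sum.cong refl sum.swap)
  also have "\<dots> = (\<Sum>j\<in>S. (\<Sum>Y\<in>Pow S. \<Sum>V\<in>Pow S. F j j V Y)
      + (\<Sum>k\<in>S - {j}. \<Sum>Y\<in>Pow S. \<Sum>V\<in>Pow S. F j k V Y))"
    using fin by (intro sum.cong refl sum.remove) auto
  also have "\<dots> = (\<Sum>j\<in>S. (\<Sum>b\<in>UNIV. side_mass S (\<lambda>V. (\<psi> V)\<^sup>2) j b * side_mass S (\<lambda>V. (\<phi> V)\<^sup>2) j b)
        + (\<Sum>b\<in>UNIV. \<Sum>k\<in>S - {j}. \<Sum>c\<in>UNIV. cross_amp S \<psi> j b k c * cross_amp S \<phi> j b k c))"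
  proof (intro sum.cong refl arg_cong2[of _ _ _ _ "(+)"])
    fix j assume j: "j \<in> S"
    have "(\<Sum>Y\<in>Pow S. \<Sum>V\<in>Pow S. F j j V Y) =
        (\<Sum>Y\<in>Pow S. \<Sum>V\<in>Pow S. \<Sum>b\<in>UNIV.
          (of_bool ((j \<in> V) = b) * (amp \<psi> j V)\<^sup>2) * (of_bool ((j \<in> Y) = b) * (amp \<phi> j Y)\<^sup>2))"
      unfolding F_def sum_bool by (intro sum.cong refl) (auto simp: power2_eq_square)
    also have "\<dots> = (\<Sum>b\<in>UNIV. (\<Sum>V\<in>Pow S. of_bool ((j \<in> V) = b) * (amp \<psi> j V)\<^sup>2) *
        (\<Sum>Y\<in>Pow S. of_bool ((j \<in> Y) = b) * (amp \<phi> j Y)\<^sup>2))"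
      unfolding sum_bool sum.distrib sum_product by (intro arg_cong2[of _ _ _ _ "(+)"] sum.swap)
    \<comment> \<open>Flipping \<open>j\<close> switches the side in both factors at once, which the
      sum over \<open>b\<close> absorbs.\<close>
    also have "\<dots> = (\<Sum>b\<in>UNIV. side_mass S (\<lambda>V. (\<psi> V)\<^sup>2) j b * side_mass S (\<lambda>V. (\<phi> V)\<^sup>2) j b)"
      unfolding side_mass_amp[OF j] sum_bool by simp
    finally show "(\<Sum>Y\<in>Pow S. \<Sum>V\<in>Pow S. F j j V Y)
        = (\<Sum>b\<in>UNIV. side_mass S (\<lambda>V. (\<psi> V)\<^sup>2) j b * side_mass S (\<lambda>V. (\<phi> V)\<^sup>2) j b)" .
    have "(\<Sum>Y\<in>Pow S. \<Sum>V\<in>Pow S. F j k V Y) =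
        (\<Sum>b\<in>UNIV. \<Sum>c\<in>UNIV. cross_amp S \<psi> j b k c * cross_amp S \<phi> j b k c)" for k
    proof -
      have "(\<Sum>Y\<in>Pow S. \<Sum>V\<in>Pow S. F j k V Y) =
        (\<Sum>Y\<in>Pow S. \<Sum>V\<in>Pow S. \<Sum>b\<in>UNIV. \<Sum>c\<in>UNIV.
          (of_bool ((j \<in> V) = b) * of_bool ((k \<in> V) = c) * (amp \<psi> j V * amp \<psi> k V)) *
          (of_bool ((j \<in> Y) = b) * of_bool ((k \<in> Y) = c) * (amp \<phi> j Y * amp \<phi> k Y)))"
        unfolding F_def sum_bool by (intro sum.cong refl) auto
      also have "\<dots> = (\<Sum>b\<in>UNIV. \<Sum>c\<in>UNIV. cross_amp S \<psi> j b k c * cross_amp S \<phi> j b k c)"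
        unfolding cross_amp_def sum_bool sum.distrib sum_product
        by (intro arg_cong2[of _ _ _ _ "(+)"] sum.swap)
      finally show ?thesis .
    qed
    then show "(\<Sum>k\<in>S - {j}. \<Sum>Y\<in>Pow S. \<Sum>V\<in>Pow S. F j k V Y)
        = (\<Sum>b\<in>UNIV. \<Sum>k\<in>S - {j}. \<Sum>c\<in>UNIV. cross_amp S \<psi> j b k c * cross_amp S \<phi> j b k c)"
      by (simp add: sum_bool sum.distrib)
  qed
  finally show ?thesis .
qed

text \<open>By \<open>wick_projection_bound\<close>, \<open>N\<close> times a local variance is at
  least \<open>N\<close> times the squared length of the vector \<open>amp \<phi> j Y\<close> minus
  its projected part \<open>Sq Y\<close>. Summed over \<open>Y\<close>, equal coordinates leave
  \<open>m e True * a e False + m e False * a e True\<close>, and distinct ones cost at most twice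
  the geometric mean of these two terms, which completes the square.\<close>

lemma local_var_lower_bound:
  assumes wick: "wick S \<psi>" and fin: "finite S"
  defines "w \<equiv> \<lambda>V. (\<psi> V)\<^sup>2"
  shows "(\<Sum>e\<in>S. (sqrt (side_mass S w e True * side_mass S (\<lambda>V. w V * (f V)\<^sup>2) e False)
      - sqrt (side_mass S w e False * side_mass S (\<lambda>V. w V * (f V)\<^sup>2) e True))\<^sup>2)
    \<le> (\<Sum>V\<in>Pow S. w V) * (\<Sum>Y\<in>Pow S. local_var S w f Y)"
proof -
  define \<phi> where "\<phi> V = \<psi> V * f V" for V
  define N where "N = (\<Sum>V\<in>Pow S. w V)"
  define m where "m e b = side_mass S w e b" for e b
  define a where "a e b = side_mass S (\<lambda>V. w V * (f V)\<^sup>2) e b" for e b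
  have phi2: "(\<phi> V)\<^sup>2 = w V * (f V)\<^sup>2" for V
    by (simp add: \<phi>_def w_def power_mult_distrib)
  have a_phi: "a e b = side_mass S (\<lambda>V. (\<phi> V)\<^sup>2) e b" for e b
    by (simp add: a_def phi2)
  have m_psi: "m e b = side_mass S (\<lambda>V. (\<psi> V)\<^sup>2) e b" for e b
    by (simp add: m_def w_def)
  have m0: "m e b \<ge> 0" and a0: "a e b \<ge> 0" for e b
    unfolding m_psi a_phi by (auto intro!: side_mass_nonneg)
  define Sq where "Sq Y = (\<Sum>V\<in>Pow S. (agree_amp S \<psi> Y V (\<lambda>j. amp \<phi> j Y))\<^sup>2)" for Y
  have N0: "N \<ge> 0"
    unfolding N_def w_def by (intro sum_nonneg) auto
  have lv: "N * (\<Sum>j\<in>S. w (flip j Y) * (f (flip j Y))\<^sup>2) - Sq Y \<le> N * local_var S w f Y"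
    if Y: "Y \<subseteq> S" for Y
  proof -
    have W: "(\<Sum>j\<in>S. (amp \<psi> j Y)\<^sup>2) = (\<Sum>j\<in>S. w (flip j Y))"
      by (simp add: power2_eq_square amp_mult_self w_def)
    have U: "(\<Sum>j\<in>S. amp \<psi> j Y * amp \<phi> j Y) = (\<Sum>j\<in>S. w (flip j Y) * f (flip j Y))"
      by (simp add: amp_mult_self \<phi>_def w_def power2_eq_square mult.assoc)
    have W0: "(\<Sum>j\<in>S. w (flip j Y)) \<ge> 0"
      unfolding w_def by (intro sum_nonneg) auto
    have Sq0: "Sq Y \<ge> 0"
      unfolding Sq_def by (intro sum_nonneg) auto
    have "N * (\<Sum>j\<in>S. w (flip j Y) * f (flip j Y))\<^sup>2 \<le> (\<Sum>j\<in>S. w (flip j Y)) * Sq Y"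
      using wick_projection_bound[OF wick fin Y, of "\<lambda>j. amp \<phi> j Y"]
      unfolding W U Sq_def N_def w_def .
    then have "N * ((\<Sum>j\<in>S. w (flip j Y) * f (flip j Y))\<^sup>2 / (\<Sum>j\<in>S. w (flip j Y))) \<le> Sq Y"
      using W0 Sq0 by (cases "(\<Sum>j\<in>S. w (flip j Y)) = 0") (auto simp: field_simps)
    then show ?thesis
      unfolding local_var_def by (simp add: right_diff_distrib)
  qed
  have diag: "(\<Sum>Y\<in>Pow S. N * (\<Sum>j\<in>S. w (flip j Y) * (f (flip j Y))\<^sup>2))
      = (\<Sum>e\<in>S. (m e True + m e False) * (a e True + a e False))"
  proof -
    have "(\<Sum>Y\<in>Pow S. \<Sum>j\<in>S. w (flip j Y) * (f (flip j Y))\<^sup>2)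
        = (\<Sum>j\<in>S. \<Sum>Y\<in>Pow S. w (flip j Y) * (f (flip j Y))\<^sup>2)"
      by (rule sum.swap)
    also have "\<dots> = (\<Sum>j\<in>S. \<Sum>Y\<in>Pow S. w Y * (f Y)\<^sup>2)"
      using sum_Pow_flip[of _ S "\<lambda>Y. w Y * (f Y)\<^sup>2"] by simp
    finally show ?thesis
      unfolding m_def a_def side_mass_total N_def sum_distrib_left[symmetric] by (simp add: sum_distrib_left)
  qed
  have off: "(\<Sum>b\<in>UNIV. \<Sum>k\<in>S - {e}. \<Sum>c\<in>UNIV. cross_amp S \<psi> e b k c * cross_amp S \<phi> e b k c)
      \<le> 2 * (sqrt (m e True * m e False) * sqrt (a e True * a e False))" if e: "e \<in> S" for e
  proof -
    have "(\<Sum>k\<in>S - {e}. \<Sum>c\<in>UNIV. cross_amp S \<psi> e b k c * cross_amp S \<phi> e b k c)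
        \<le> sqrt (m e True * m e False) * sqrt (a e True * a e False)" for b
    proof -
      define X where "X = (\<Sum>z\<in>(S - {e}) \<times> UNIV.
          cross_amp S \<psi> e b (fst z) (snd z) * cross_amp S \<phi> e b (fst z) (snd z))"
      have "X\<^sup>2 \<le> (\<Sum>z\<in>(S - {e}) \<times> UNIV. (cross_amp S \<psi> e b (fst z) (snd z))\<^sup>2)
          * (\<Sum>z\<in>(S - {e}) \<times> UNIV. (cross_amp S \<phi> e b (fst z) (snd z))\<^sup>2)"
        unfolding X_def by (rule Cauchy_Schwarz_ineq_sum)
      also have "\<dots> \<le> (m e True * m e False) * (a e True * a e False)"
        using cross_amp_bound[OF fin e, of \<psi> b] cross_amp_bound[OF fin e, of \<phi> b]
        unfolding m_psi a_phi
        by (intro mult_mono) (auto simp: sum.cartesian_product split_def intro!: sum_nonneg mult_nonneg_nonneg side_mass_nonneg)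
      finally have "X \<le> sqrt ((m e True * m e False) * (a e True * a e False))"
        by (intro real_le_rsqrt)
      then show ?thesis
        by (simp add: X_def sum.cartesian_product split_def real_sqrt_mult)
    qed
    from this[of True] this[of False] show ?thesis
      unfolding sum_bool[of "\<lambda>b. \<Sum>k\<in>S - {e}. \<Sum>c\<in>UNIV. cross_amp S \<psi> e b k c * cross_amp S \<phi> e b k c"]
      by linarith
  qed
  have "(\<Sum>e\<in>S. (sqrt (m e True * a e False) - sqrt (m e False * a e True))\<^sup>2)
      = (\<Sum>e\<in>S. (m e True + m e False) * (a e True + a e False)
          - (m e True * a e True + m e False * a e False
            + 2 * (sqrt (m e True * m e False) * sqrt (a e True * a e False))))"
    using m0 a0
    by (intro sum.cong refl) (simp add: power2_diff real_sqrt_mult algebra_simps)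
  also have "\<dots> \<le> (\<Sum>e\<in>S. (m e True + m e False) * (a e True + a e False)
          - ((\<Sum>b\<in>UNIV. m e b * a e b)
             + (\<Sum>b\<in>UNIV. \<Sum>k\<in>S - {e}. \<Sum>c\<in>UNIV. cross_amp S \<psi> e b k c * cross_amp S \<phi> e b k c)))"
  proof (intro sum_mono diff_left_mono add_mono off)
    fix e show "(\<Sum>b\<in>UNIV. m e b * a e b) \<le> m e True * a e True + m e False * a e False"
      by (simp add: sum_bool)
  qed
  also have "\<dots> = (\<Sum>Y\<in>Pow S. N * (\<Sum>j\<in>S. w (flip j Y) * (f (flip j Y))\<^sup>2)) - (\<Sum>Y\<in>Pow S. Sq Y)"
    unfolding diag Sq_def sum_agree_amp_square[OF fin] sum_subtractf m_psi a_phi ..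
  also have "\<dots> = (\<Sum>Y\<in>Pow S. N * (\<Sum>j\<in>S. w (flip j Y) * (f (flip j Y))\<^sup>2) - Sq Y)"
    by (simp add: sum_subtractf)
  also have "\<dots> \<le> (\<Sum>Y\<in>Pow S. N * local_var S w f Y)"
    using lv by (intro sum_mono) auto
  finally show ?thesis
    by (simp add: m_def a_def N_def sum_distrib_left)
qed

section \<open>The logarithmic Sobolev inequality\<close>

text \<open>Exchange argument: fix a supported \<open>x\<close> on side \<open>b\<close>. For a
  supported \<open>y\<close> on the other side, the Wick relation at \<open>flip e y\<close> and
  \<open>flip e x\<close> has a nonzero term at \<open>e\<close>, hence another at some
  \<open>j\<close>, and \<open>flip e (flip j y)\<close> is supported on the side of
  \<open>x\<close>. For each of the \<open>card S - 1\<close> indices \<open>j\<close> this map is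
  injective. Weights in \<open>{0, 1}\<close> let the existence of one such \<open>j\<close> be read
  as the inequality \<open>exch\<close>.\<close>

lemma wick_side_mass_ratio:
  assumes wick: "wick S \<psi>" and fin: "finite S" and e: "e \<in> S"
    and unit: "\<And>V. V \<subseteq> S \<Longrightarrow> (\<psi> V)\<^sup>2 \<in> {0, 1}"
    and pos: "side_mass S (\<lambda>V. (\<psi> V)\<^sup>2) e b > 0"
  shows "side_mass S (\<lambda>V. (\<psi> V)\<^sup>2) e (\<not> b)
    \<le> (real (card S) - 1) * side_mass S (\<lambda>V. (\<psi> V)\<^sup>2) e b"
proof -
  define w where "w V = (\<psi> V)\<^sup>2" for V
  have w0: "w V \<ge> 0" for V
    by (simp add: w_def)
  obtain x where x: "x \<subseteq> S" "(e \<in> x) = b" "\<psi> x \<noteq> 0"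
  proof -
    have "\<exists>V\<in>Pow S. of_bool ((e \<in> V) = b) * (\<psi> V)\<^sup>2 \<noteq> 0"
      using pos unfolding side_mass_def by (metis (no_types, lifting) less_irrefl sum.neutral)
    then show ?thesis using that by auto
  qed
  have exch: "w y \<le> (\<Sum>j\<in>S - {e}. w (flip e (flip j y)))" if y: "y \<subseteq> S" "(e \<in> y) = (\<not> b)" for y
  proof (cases "\<psi> y = 0")
    case True
    then show ?thesis
      using w0 by (auto simp: w_def intro: sum_nonneg)
  next
    case False
    let ?t = "\<lambda>j. of_bool ((j \<in> flip e y) \<noteq> (j \<in> flip e x)) * (amp \<psi> j (flip e y) * amp \<psi> j (flip e x))"
    have "(\<Sum>j\<in>S. ?t j) = 0"
      using x y e by (intro wick_amp[OF wick fin]) (auto simp: flip_subset)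
    moreover have "(\<Sum>j\<in>S. ?t j) = ?t e + (\<Sum>j\<in>S - {e}. ?t j)"
      using fin e by (rule sum.remove)
    moreover have "?t e \<noteq> 0"
      using x y False by (auto simp: amp_def sgn_at_def)
    ultimately have "(\<Sum>j\<in>S - {e}. ?t j) \<noteq> 0"
      by linarith
    then obtain j where j: "j \<in> S - {e}" "?t j \<noteq> 0"
      by (metis (no_types, lifting) sum.neutral)
    then have "\<psi> (flip j (flip e y)) \<noteq> 0"
      by (auto simp: amp_def)
    moreover have sub: "flip e (flip j y) \<subseteq> S" "flip j (flip e y) = flip e (flip j y)"
      using y j e by (auto simp: flip_subset flip_commute)
    ultimately have "w (flip e (flip j y)) = 1"
      using unit[OF sub(1)] by (auto simp: w_def)
    moreover have "w y = 1"
      using unit[OF y(1)] False by (auto simp: w_def)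
    moreover have "w (flip e (flip j y)) \<le> (\<Sum>j\<in>S - {e}. w (flip e (flip j y)))"
      using fin j w0 by (intro member_le_sum) auto
    ultimately show ?thesis by simp
  qed
  have "side_mass S w e (\<not> b) \<le> (\<Sum>y\<in>Pow S. of_bool ((e \<in> y) = (\<not> b)) * (\<Sum>j\<in>S - {e}. w (flip e (flip j y))))"
    unfolding side_mass_def using exch by (intro sum_mono) auto
  also have "\<dots> = (\<Sum>j\<in>S - {e}. \<Sum>y\<in>Pow S. of_bool ((e \<in> y) = (\<not> b)) * w (flip e (flip j y)))"
    unfolding sum_distrib_left by (rule sum.swap)
  also have "\<dots> = (\<Sum>j\<in>S - {e}. side_mass S w e b)"
  proof (intro sum.cong refl)
    fix j assume j: "j \<in> S - {e}"
    let ?g = "\<lambda>V. of_bool ((e \<in> V) = b) * w V"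
    have "(\<Sum>y\<in>Pow S. of_bool ((e \<in> y) = (\<not> b)) * w (flip e (flip j y)))
        = (\<Sum>y\<in>Pow S. ?g (flip e (flip j y)))"
      using j by (intro sum.cong refl) auto
    also have "\<dots> = (\<Sum>y\<in>Pow S. ?g y)"
      using sum_Pow_flip[OF e, of ?g] sum_Pow_flip[of j S "\<lambda>y. ?g (flip e y)"] j by simp
    finally show "(\<Sum>y\<in>Pow S. of_bool ((e \<in> y) = (\<not> b)) * w (flip e (flip j y))) = side_mass S w e b"
      by (simp add: side_mass_def)
  qed
  also have "\<dots> = (real (card S) - 1) * side_mass S w e b"
  proof -
    have "card S \<ge> 1"
      using fin e by (auto simp: Suc_le_eq card_gt_0_iff)
    then show ?thesis
      using fin e by (simp add: card_Diff_singleton of_nat_diff)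
  qed
  finally show ?thesis
    by (simp add: w_def[abs_def])
qed

text \<open>Along the segment \<open>s \<mapsto> (c + q s, c - p s)\<close> of constant mean, the second derivative of the
  entropy is at most \<open>2 p q (2 + q ln (a\<^sup>2/m) + p ln (b\<^sup>2/m))\<close>.\<close>

lemma two_point_log_sobolev_ordered:
  fixes p q a b n :: real
  assumes p: "p > 0" and q: "q > 0" and pq: "p + q = 1" and n: "1 \<le> n * p" "1 \<le> n * q"
    and ab: "b \<le> a" "0 \<le> b"
  shows "p * a\<^sup>2 * ln (a\<^sup>2) + q * b\<^sup>2 * ln (b\<^sup>2) - (p * a\<^sup>2 + q * b\<^sup>2) * ln (p * a\<^sup>2 + q * b\<^sup>2)
    \<le> (ln n + 2) * (p * q * (a - b)\<^sup>2)"
proof (cases "b = 0")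
  case True
  \<comment> \<open>For \<open>b = 0\<close> the derivatives below would meet \<open>ln 0\<close>.
    The claim now comes down to \<open>- ln p \<le> q * (ln n + 2)\<close>, which follows from
    \<open>ln x \<le> x - 1\<close> at \<open>x = 1 / p\<close> and from
    \<open>1 / p \<le> n\<close>.\<close>
  have p1: "p = 1 - q" using pq by simp
  have n0: "n > 0"
    using n(1) p by (smt (verit) mult_nonpos_nonneg)
  have "1 / p \<le> n"
    using n p by (simp add: field_simps)
  then have L: "- ln p \<le> ln n"
  proof -
    have "ln (1 / p) \<le> ln n"
      using \<open>1 / p \<le> n\<close> p n0 by (subst ln_le_cancel_iff) auto
    then show ?thesis
      using p by (simp add: ln_div)
  qed
  have "- ln p \<le> 1 / p - 1"
    using ln_le_minus_one[of "1 / p"] p by (simp add: ln_div)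
  then have "p * (- ln p) \<le> q"
    using p pq by (simp add: field_simps)
  then have "- ln p \<le> q * (- ln p + 2)"
  proof -
    have "p * (- ln p) = - ln p - q * (- ln p)"
      by (simp add: p1 algebra_simps)
    then show ?thesis
      using \<open>p * (- ln p) \<le> q\<close> q unfolding distrib_left by linarith
  qed
  also have "\<dots> \<le> q * (ln n + 2)"
    using L q by (intro mult_left_mono) auto
  finally have "(p * a\<^sup>2) * (- ln p) \<le> (p * a\<^sup>2) * (q * (ln n + 2))"
    using p by (intro mult_left_mono) auto
  moreover have "p * a\<^sup>2 * ln (a\<^sup>2) - p * a\<^sup>2 * ln (p * a\<^sup>2) = (p * a\<^sup>2) * (- ln p)"
    using p by (cases "a = 0") (simp_all add: ln_mult algebra_simps)
  ultimately show ?thesis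
    using True by (simp add: algebra_simps)
next
  case False
  then have b: "b > 0" and a: "a > 0"
    using ab by auto
  have n0: "n > 0"
    using n(1) p by (smt (verit) mult_nonpos_nonneg)
  define K where "K = ln n + 2"
  define c where "c = p * a + q * b"
  define A where "A s = c + q * s" for s
  define B where "B s = c - p * s" for s
  define M where "M s = p * (A s)\<^sup>2 + q * (B s)\<^sup>2" for s
  \<comment> \<open>\<open>\<xi>\<close> is the slack of the inequality along the segment; it
    vanishes at \<open>s = 0\<close> and has derivative \<open>2 * p * q * \<zeta> s\<close>.
    Monotonicity is shown first for \<open>\<zeta>\<close>, then for \<open>\<xi>\<close>.\<close>
  define \<xi> where "\<xi> s = K * (p * q * s\<^sup>2)
    - (2 * p * ((A s)\<^sup>2 * ln (A s)) + 2 * q * ((B s)\<^sup>2 * ln (B s)) - M s * ln (M s))" for s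
  define \<zeta> where "\<zeta> s = K * s - 2 * (A s * ln (A s)) + 2 * (B s * ln (B s)) + s * ln (M s)" for s
  have pa: "q = 1 - p" using pq by simp
  have c0: "c > 0"
    using p q a b by (simp add: c_def add_pos_pos)
  have A_end: "A (a - b) = a" and B_end: "B (a - b) = b"
    by (simp_all add: A_def B_def c_def pa algebra_simps)
  have pos: "A s > 0" "B s > 0" "M s > 0" if s: "0 \<le> s" "s \<le> a - b" for s
  proof -
    show A0: "A s > 0"
      unfolding A_def using c0 q s by (intro add_pos_nonneg) auto
    have "p * s \<le> p * (a - b)"
      using p s by (intro mult_left_mono) auto
    then show B0: "B s > 0"
      using b B_end unfolding B_def by linarith
    show "M s > 0"
      unfolding M_def using A0 B0 p q by (intro add_pos_pos mult_pos_pos) auto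
  qed
  have dA: "(A has_real_derivative q) (at s)" and dB: "(B has_real_derivative - p) (at s)" for s
    unfolding A_def B_def by (auto intro!: derivative_eq_intros)
  have dM: "(M has_real_derivative 2 * p * q * s) (at s)" for s
    unfolding M_def
    by (auto intro!: derivative_eq_intros dA dB) (simp add: A_def B_def pa algebra_simps)
  have dz: "\<exists>y. (\<zeta> has_real_derivative y) (at s) \<and> 0 \<le> y" if s: "0 \<le> s" "s \<le> a - b" for s
  proof (intro exI conjI)
    note P = pos[OF s]
    show "(\<zeta> has_real_derivative
        (K - 2 * (q * ln (A s) + q) + 2 * (- p * ln (B s) - p) + (ln (M s) + s * (2 * p * q * s / M s)))) (at s)"
      unfolding \<zeta>_def using P
      by (auto intro!: derivative_eq_intros dA dB dM simp: field_simps)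
    \<comment> \<open>One atom carries at most the whole second moment,
      \<open>p * (A s)\<^sup>2 \<le> M s\<close>, and \<open>1 \<le> n * p\<close>. This is where
      \<open>ln n\<close> enters.\<close>
    have lnA: "2 * ln (A s) \<le> ln n + ln (M s)"
    proof -
      have "(A s)\<^sup>2 * 1 \<le> (A s)\<^sup>2 * (n * p)"
        using n by (intro mult_left_mono) auto
      also have "\<dots> \<le> n * M s"
        using n0 q by (simp add: M_def algebra_simps)
      finally have "ln ((A s)\<^sup>2) \<le> ln (n * M s)"
        using P n0 by (subst ln_le_cancel_iff) auto
      then show ?thesis
        using P n0 by (simp add: ln_mult ln_realpow)
    qed
    have lnB: "2 * ln (B s) \<le> ln n + ln (M s)"
    proof -
      have "(B s)\<^sup>2 * 1 \<le> (B s)\<^sup>2 * (n * q)"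
        using n by (intro mult_left_mono) auto
      also have "\<dots> \<le> n * M s"
        using n0 p by (simp add: M_def algebra_simps)
      finally have "ln ((B s)\<^sup>2) \<le> ln (n * M s)"
        using P n0 by (subst ln_le_cancel_iff) auto
      then show ?thesis
        using P n0 by (simp add: ln_mult ln_realpow)
    qed
    have "q * (2 * ln (A s)) + p * (2 * ln (B s)) \<le> q * (ln n + ln (M s)) + p * (ln n + ln (M s))"
      using p q lnA lnB by (intro add_mono mult_left_mono) auto
    also have "\<dots> = ln n + ln (M s)"
      by (simp add: pa algebra_simps)
    finally have "q * (2 * ln (A s)) + p * (2 * ln (B s)) \<le> ln n + ln (M s)" .
    moreover have "s * (2 * p * q * s / M s) \<ge> 0"
      using P p q s by simp
    ultimately show "0 \<le> K - 2 * (q * ln (A s) + q) + 2 * (- p * ln (B s) - p)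
        + (ln (M s) + s * (2 * p * q * s / M s))"
      using pq by (simp add: K_def algebra_simps)
  qed
  have \<zeta>_nonneg: "\<zeta> s \<ge> 0" if s: "0 \<le> s" "s \<le> a - b" for s
  proof -
    have "\<zeta> 0 \<le> \<zeta> s"
    proof (rule DERIV_nonneg_imp_nondecreasing[where f = \<zeta>, OF s(1)])
      fix x assume "0 \<le> x" "x \<le> s"
      then show "\<exists>y. (\<zeta> has_real_derivative y) (at x) \<and> 0 \<le> y"
        using s(2) by (intro dz) linarith+
    qed
    then show ?thesis
      by (simp add: \<zeta>_def A_def B_def)
  qed
  have "\<xi> 0 \<le> \<xi> (a - b)"
  proof (rule DERIV_nonneg_imp_nondecreasing[where f = \<xi>])
    show "0 \<le> a - b" using ab by simp
    fix s assume s: "0 \<le> s" "s \<le> a - b"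
    note P = pos[OF s]
    have dAl: "((\<lambda>s. (A s)\<^sup>2 * ln (A s)) has_real_derivative q * (2 * (A s * ln (A s)) + A s)) (at s)"
      using P by (auto intro!: derivative_eq_intros dA) (simp add: power2_eq_square algebra_simps)
    have dBl: "((\<lambda>s. (B s)\<^sup>2 * ln (B s)) has_real_derivative - p * (2 * (B s * ln (B s)) + B s)) (at s)"
      using P by (auto intro!: derivative_eq_intros dB) (simp add: power2_eq_square algebra_simps)
    have dMl: "((\<lambda>s. M s * ln (M s)) has_real_derivative 2 * p * q * s * (ln (M s) + 1)) (at s)"
      using P by (auto intro!: derivative_eq_intros dM) (simp add: algebra_simps)
    have "((\<lambda>s. s\<^sup>2) has_real_derivative 2 * s) (at s)"
      by (auto intro!: derivative_eq_intros)
    then have "(\<xi> has_real_derivative K * (p * q * (2 * s))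
        - (2 * p * (q * (2 * (A s * ln (A s)) + A s)) + 2 * q * (- p * (2 * (B s * ln (B s)) + B s))
          - 2 * p * q * s * (ln (M s) + 1))) (at s)"
      unfolding \<xi>_def by (intro DERIV_diff DERIV_add DERIV_cmult dAl dBl dMl)
    moreover have "A s - B s = s"
      by (simp add: A_def B_def pa algebra_simps)
    then have "2 * p * q * A s = 2 * p * q * B s + 2 * p * q * s"
      by (simp flip: distrib_left)
    then have "K * (p * q * (2 * s))
        - (2 * p * (q * (2 * (A s * ln (A s)) + A s)) + 2 * q * (- p * (2 * (B s * ln (B s)) + B s))
          - 2 * p * q * s * (ln (M s) + 1)) = 2 * p * q * \<zeta> s"
      by (simp add: \<zeta>_def algebra_simps)
    ultimately have "(\<xi> has_real_derivative 2 * p * q * \<zeta> s) (at s)"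
      by (simp only:)
    then show "\<exists>y. (\<xi> has_real_derivative y) (at s) \<and> 0 \<le> y"
      using p q \<zeta>_nonneg[OF s] by (intro exI[of _ "2 * p * q * \<zeta> s"]) auto
  qed
  moreover have "\<xi> 0 = 0"
  proof -
    have "M 0 = c\<^sup>2" by (simp add: M_def A_def B_def pa algebra_simps)
    then show ?thesis
      using c0 by (simp add: \<xi>_def A_def B_def ln_realpow pa algebra_simps)
  qed
  ultimately show ?thesis
    using a b by (simp add: \<xi>_def A_end B_end M_def K_def ln_realpow mult_ac)
qed

lemma two_point_log_sobolev:
  fixes p q a b n :: real
  assumes "p > 0" "q > 0" "p + q = 1" "1 \<le> n * p" "1 \<le> n * q" "0 \<le> a" "0 \<le> b"
  shows "p * a\<^sup>2 * ln (a\<^sup>2) + q * b\<^sup>2 * ln (b\<^sup>2) - (p * a\<^sup>2 + q * b\<^sup>2) * ln (p * a\<^sup>2 + q * b\<^sup>2)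
    \<le> (ln n + 2) * (p * q * (a - b)\<^sup>2)"
proof (cases "b \<le> a")
  case True
  then show ?thesis
    using two_point_log_sobolev_ordered[of p q n b a] assms by simp
next
  case False
  then show ?thesis
    using two_point_log_sobolev_ordered[of q p n a b] assms
    by (simp add: power2_commute add.commute mult.commute[of q p])
qed

text \<open>Homogeneous form, obtained by scaling with the total mass and taking the root mean
  squares \<open>sqrt (A0 / N0)\<close> and \<open>sqrt (A1 / N1)\<close> as the two values. The
  ratio bounds say that both probabilities are at least \<open>1 / n\<close>; if a mass is 0, the
  left side is 0.\<close>

lemma two_point_log_sobolev_masses:
  fixes N0 N1 A0 A1 n :: real
  assumes N: "N0 \<ge> 0" "N1 \<ge> 0" and A: "A0 \<ge> 0" "A1 \<ge> 0"
    and zero: "N0 = 0 \<Longrightarrow> A0 = 0" "N1 = 0 \<Longrightarrow> A1 = 0"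
    and ratio: "N0 > 0 \<Longrightarrow> N1 \<le> (n - 1) * N0" "N1 > 0 \<Longrightarrow> N0 \<le> (n - 1) * N1" and n: "n \<ge> 1"
  shows "A0 * ln (A0 / N0) + A1 * ln (A1 / N1) - (A0 + A1) * ln ((A0 + A1) / (N0 + N1))
    \<le> (ln n + 2) * ((sqrt (N1 * A0) - sqrt (N0 * A1))\<^sup>2 / (N0 + N1))"
proof (cases "N0 > 0 \<and> N1 > 0")
  case False
  have "(ln n + 2) * ((sqrt (N1 * A0) - sqrt (N0 * A1))\<^sup>2 / (N0 + N1)) \<ge> 0"
    using N n by (intro mult_nonneg_nonneg divide_nonneg_nonneg add_nonneg_nonneg) auto
  moreover have "A0 * ln (A0 / N0) + A1 * ln (A1 / N1) - (A0 + A1) * ln ((A0 + A1) / (N0 + N1)) = 0"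
    using False N zero by (cases "N0 = 0"; cases "N1 = 0") auto
  ultimately show ?thesis by linarith
next
  case True
  define T where "T = N0 + N1"
  have T: "T > 0" using True by (simp add: T_def)
  define p where "p = N0 / T"
  define q where "q = N1 / T"
  define a where "a = sqrt (A0 / N0)"
  define b where "b = sqrt (A1 / N1)"
  have a2: "a\<^sup>2 = A0 / N0" and b2: "b\<^sup>2 = A1 / N1"
    using A True by (simp_all add: a_def b_def)
  have A0: "A0 = T * (p * a\<^sup>2)" and A1: "A1 = T * (q * b\<^sup>2)"
    using True T by (simp_all add: p_def q_def a2 b2)
  have "p * a\<^sup>2 * ln (a\<^sup>2) + q * b\<^sup>2 * ln (b\<^sup>2) - (p * a\<^sup>2 + q * b\<^sup>2) * ln (p * a\<^sup>2 + q * b\<^sup>2)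
    \<le> (ln n + 2) * (p * q * (a - b)\<^sup>2)"
  proof (rule two_point_log_sobolev)
    show "p > 0" "q > 0" using True T by (simp_all add: p_def q_def)
    show "p + q = 1" using T by (simp add: p_def q_def T_def flip: add_divide_distrib)
    show "1 \<le> n * p" "1 \<le> n * q"
      using T ratio True by (simp_all add: p_def q_def T_def field_simps)
    show "0 \<le> a" "0 \<le> b" using A True by (simp_all add: a_def b_def)
  qed
  then have "T * (p * a\<^sup>2 * ln (a\<^sup>2) + q * b\<^sup>2 * ln (b\<^sup>2) - (p * a\<^sup>2 + q * b\<^sup>2) * ln (p * a\<^sup>2 + q * b\<^sup>2))
    \<le> T * ((ln n + 2) * (p * q * (a - b)\<^sup>2))"
    using T by (intro mult_left_mono) auto
  moreover have "T * (p * a\<^sup>2 * ln (a\<^sup>2) + q * b\<^sup>2 * ln (b\<^sup>2) - (p * a\<^sup>2 + q * b\<^sup>2) * ln (p * a\<^sup>2 + q * b\<^sup>2))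
      = A0 * ln (A0 / N0) + A1 * ln (A1 / N1) - (A0 + A1) * ln ((A0 + A1) / (N0 + N1))"
  proof -
    have "p * a\<^sup>2 + q * b\<^sup>2 = (A0 + A1) / T"
      using T by (simp add: A0 A1 flip: distrib_left)
    moreover have "T * (p * a\<^sup>2 * u + q * b\<^sup>2 * v - z * t) = A0 * u + A1 * v - T * z * t" for u v z t
      by (simp add: A0 A1 algebra_simps)
    moreover have "T * ((A0 + A1) / T) = A0 + A1"
      using T by simp
    ultimately show ?thesis
      by (simp only: a2 b2 T_def[symmetric])
  qed
  moreover have "T * ((ln n + 2) * (p * q * (a - b)\<^sup>2))
      = (ln n + 2) * ((sqrt (N1 * A0) - sqrt (N0 * A1))\<^sup>2 / (N0 + N1))"
  proof -
    have "sqrt (N1 * A0) = sqrt (N0 * N1) * a" "sqrt (N0 * A1) = sqrt (N0 * N1) * b"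
      using True A by (simp_all add: a_def b_def flip: real_sqrt_mult)
    then have "(sqrt (N1 * A0) - sqrt (N0 * A1))\<^sup>2 = N0 * N1 * (a - b)\<^sup>2"
      using True by (simp flip: right_diff_distrib add: power_mult_distrib)
    then show ?thesis
      using T by (simp add: p_def q_def T_def[symmetric])
  qed
  ultimately show ?thesis by simp
qed

section \<open>Chain rule for the entropy and induction on the free coordinates\<close>

definition mass_entropy :: "nat set \<Rightarrow> (nat set \<Rightarrow> real) \<Rightarrow> (nat set \<Rightarrow> real) \<Rightarrow> real" where
  "mass_entropy S w g = (\<Sum>V\<in>Pow S. w V * (g V * ln (g V)))
     - (\<Sum>V\<in>Pow S. w V * g V) * ln ((\<Sum>V\<in>Pow S. w V * g V) / (\<Sum>V\<in>Pow S. w V))"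

lemma sum_Pow_split:
  assumes "finite S" "e \<in> S"
  shows "(\<Sum>V\<in>Pow S. F V) = (\<Sum>V\<in>Pow (S - {e}). F V) + (\<Sum>V\<in>Pow (S - {e}). F (insert e V))"
proof -
  have "Pow S = Pow (insert e (S - {e}))"
    using assms by (simp add: insert_absorb)
  also have "\<dots> = Pow (S - {e}) \<union> insert e ` Pow (S - {e})"
    by (rule Pow_insert)
  finally have "(\<Sum>V\<in>Pow S. F V) = (\<Sum>V\<in>Pow (S - {e}). F V) + (\<Sum>V\<in>insert e ` Pow (S - {e}). F V)"
    using assms by (simp only:) (rule sum.union_disjoint, auto)
  also have "(\<Sum>V\<in>insert e ` Pow (S - {e}). F V) = (\<Sum>V\<in>Pow (S - {e}). F (insert e V))"
  proof (rule sum.reindex_cong[of "insert e"])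
    show "inj_on (insert e) (Pow (S - {e}))"
      by (rule inj_onI) auto
  qed auto
  finally show ?thesis .
qed

lemma side_mass_Pow:
  assumes "finite S" "e \<in> S"
  shows "side_mass S w e False = (\<Sum>V\<in>Pow (S - {e}). w V)"
    "side_mass S w e True = (\<Sum>V\<in>Pow (S - {e}). w (insert e V))"
proof -
  have old: "(\<Sum>V\<in>Pow (S - {e}). of_bool ((e \<in> V) = b) * w V) =
      (if b then 0 else \<Sum>V\<in>Pow (S - {e}). w V)" for b
    by (cases b) (auto intro!: sum.cong sum.neutral)
  show "side_mass S w e False = (\<Sum>V\<in>Pow (S - {e}). w V)"
    "side_mass S w e True = (\<Sum>V\<in>Pow (S - {e}). w (insert e V))"
    unfolding side_mass_def sum_Pow_split[OF assms] old by simp_all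
qed

text \<open>Chain rule: the mean terms of the two conditioned parts cancel against the first two
  terms of the two-point entropy of the aggregated masses.\<close>

lemma mass_entropy_split:
  assumes "finite S" "e \<in> S"
  shows "mass_entropy S w g =
    mass_entropy (S - {e}) w g + mass_entropy (S - {e}) (\<lambda>V. w (insert e V)) (\<lambda>V. g (insert e V))
    + (let N = side_mass S w e; A = side_mass S (\<lambda>V. w V * g V) e in
        A False * ln (A False / N False) + A True * ln (A True / N True)
        - (A False + A True) * ln ((A False + A True) / (N False + N True)))"
  unfolding mass_entropy_def Let_def side_mass_Pow[OF assms] sum_Pow_split[OF assms] by simp

lemma local_var_le:
  assumes "finite J" and w: "\<And>V. w V \<ge> 0"
  shows "local_var J w f Y \<le> (\<Sum>j\<in>J. w (flip j Y) * (f (flip j Y) - c)\<^sup>2)"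
    and "local_var J w f Y = (\<Sum>j\<in>J. w (flip j Y) *
      (f (flip j Y) - (\<Sum>j\<in>J. w (flip j Y) * f (flip j Y)) / (\<Sum>j\<in>J. w (flip j Y)))\<^sup>2)"
proof -
  define W where "W = (\<Sum>j\<in>J. w (flip j Y))"
  define s where "s = (\<Sum>j\<in>J. w (flip j Y) * f (flip j Y))"
  have expand: "(\<Sum>j\<in>J. w (flip j Y) * (f (flip j Y) - c)\<^sup>2)
      = (\<Sum>j\<in>J. w (flip j Y) * (f (flip j Y))\<^sup>2) - 2 * c * s + c\<^sup>2 * W" for c
    unfolding s_def W_def sum_distrib_left sum_subtractf[symmetric] sum.distrib[symmetric]
    by (intro sum.cong refl) (simp add: power2_eq_square algebra_simps)
  have W0: "W \<ge> 0"
    unfolding W_def using w by (intro sum_nonneg) auto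
  have s0: "s = 0" if "W = 0"
  proof -
    have "\<forall>j\<in>J. w (flip j Y) = 0"
      using that assms unfolding W_def by (subst (asm) sum_nonneg_eq_0_iff) auto
    then show ?thesis unfolding s_def by simp
  qed
  have "- (s\<^sup>2 / W) \<le> - 2 * c * s + c\<^sup>2 * W"
  proof (cases "W = 0")
    case True
    then show ?thesis using s0 by simp
  next
    case False
    then have "W > 0" using W0 by simp
    have "0 \<le> (s - c * W)\<^sup>2 / W" using W0 by simp
    also have "\<dots> = s\<^sup>2 / W - 2 * c * s + c\<^sup>2 * W"
      using \<open>W > 0\<close> by (simp add: power2_eq_square field_simps)
    finally show ?thesis by linarith
  qed
  then show "local_var J w f Y \<le> (\<Sum>j\<in>J. w (flip j Y) * (f (flip j Y) - c)\<^sup>2)"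
    unfolding expand local_var_def s_def[symmetric] W_def[symmetric] by linarith
  show "local_var J w f Y = (\<Sum>j\<in>J. w (flip j Y) *
      (f (flip j Y) - (\<Sum>j\<in>J. w (flip j Y) * f (flip j Y)) / (\<Sum>j\<in>J. w (flip j Y)))\<^sup>2)"
    unfolding s_def[symmetric] W_def[symmetric] expand
    unfolding local_var_def s_def[symmetric] W_def[symmetric]
    using s0 by (cases "W = 0") (auto simp: power2_eq_square)
qed

lemma local_var_nonneg:
  assumes "finite J" "\<And>V. w V \<ge> 0"
  shows "local_var J w f Y \<ge> 0"
  unfolding local_var_le(2)[of J w f Y, OF assms] using assms(2) by (intro sum_nonneg) auto

text \<open>All variances are compared at the mean for the full \<open>S\<close>, which can only
  enlarge them; each \<open>j\<close> is then counted for every \<open>e\<close> except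
  \<open>e = j\<close>.\<close>

lemma sum_local_var_remove:
  assumes fin: "finite S" and w: "\<And>V. w V \<ge> 0"
  shows "(\<Sum>e\<in>S. local_var (S - {e}) w f Y) \<le> (real (card S) - 1) * local_var S w f Y"
proof -
  define c where "c = (\<Sum>j\<in>S. w (flip j Y) * f (flip j Y)) / (\<Sum>j\<in>S. w (flip j Y))"
  define d where "d j = w (flip j Y) * (f (flip j Y) - c)\<^sup>2" for j
  have "(\<Sum>e\<in>S. local_var (S - {e}) w f Y) \<le> (\<Sum>e\<in>S. \<Sum>j\<in>S - {e}. d j)"
    unfolding d_def using fin w by (intro sum_mono local_var_le(1)) auto
  also have "\<dots> = (\<Sum>e\<in>S. (\<Sum>j\<in>S. d j) - d e)"
    using fin by (intro sum.cong refl) (simp add: sum_diff1)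
  also have "\<dots> = (real (card S) - 1) * (\<Sum>j\<in>S. d j)"
    by (simp add: sum_subtractf algebra_simps)
  also have "(\<Sum>j\<in>S. d j) = local_var S w f Y"
    unfolding d_def c_def using local_var_le(2)[of S w f Y, OF fin w] by simp
  finally show ?thesis .
qed

lemma sum_local_var_pin:
  assumes fin: "finite S" and e: "e \<in> S"
  shows "(\<Sum>Y\<in>Pow (S - {e}). local_var (S - {e}) w f Y)
    + (\<Sum>Y\<in>Pow (S - {e}). local_var (S - {e}) (\<lambda>V. w (insert e V)) (\<lambda>V. f (insert e V)) Y)
    = (\<Sum>Y\<in>Pow S. local_var (S - {e}) w f Y)"
proof -
  have "flip j (insert e Y) = insert e (flip j Y)" if "j \<in> S - {e}" for j Y
    using that by (auto simp: set_eq_iff)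
  then have "local_var (S - {e}) (\<lambda>V. w (insert e V)) (\<lambda>V. f (insert e V)) Y
      = local_var (S - {e}) w f (insert e Y)" for Y
    unfolding local_var_def by simp
  then show ?thesis
    unfolding sum_Pow_split[OF assms] by simp
qed

text \<open>Sum the chain rule over all \<open>e \<in> S\<close>. The pinned parts contribute
  \<open>card S - 1\<close> times the local variances by \<open>sum_local_var_remove\<close>, the
  two-point parts contribute them once more by \<open>local_var_lower_bound\<close>, and dividing by
  \<open>card S\<close> restores the constant. The bound \<open>n\<close> stays fixed while
  \<open>S\<close> shrinks, so the constant does not accumulate. A pinned part may have
  \<open>\<psi>\<close> identically 0, which the hypotheses permit.\<close>

theorem log_sobolev_masses:
  assumes "finite S" "card S \<le> n" "n \<ge> 1" "wick S \<psi>"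
    and "\<And>V. V \<subseteq> S \<Longrightarrow> (\<psi> V)\<^sup>2 \<in> {0, 1}"
  shows "mass_entropy S (\<lambda>V. (\<psi> V)\<^sup>2) (\<lambda>V. (f V)\<^sup>2)
    \<le> (ln (real n) + 2) * (\<Sum>Y\<in>Pow S. local_var S (\<lambda>V. (\<psi> V)\<^sup>2) f Y)"
  using assms
proof (induction "card S" arbitrary: S \<psi> f)
  case 0
  then have S: "S = {}" by simp
  show ?case
    by (cases "\<psi> {} = 0") (auto simp: S mass_entropy_def local_var_def)
next
  case (Suc m)
  note fin = \<open>finite S\<close> and wick = \<open>wick S \<psi>\<close> and unit = Suc.prems(5)
  define w where "w V = (\<psi> V)\<^sup>2" for V
  define g where "g V = (f V)\<^sup>2" for V
  define K where "K = ln (real n) + 2"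
  define D where "D = (\<Sum>Y\<in>Pow S. local_var S w f Y)"
  define T where "T = (\<Sum>V\<in>Pow S. w V)"
  define N where "N e b = side_mass S w e b" for e b
  define A where "A e b = side_mass S (\<lambda>V. w V * g V) e b" for e b
  define E where "E e = A e False * ln (A e False / N e False) + A e True * ln (A e True / N e True)
        - (A e False + A e True) * ln ((A e False + A e True) / (N e False + N e True))" for e
  define Q where "Q e = (sqrt (N e True * A e False) - sqrt (N e False * A e True))\<^sup>2" for e
  have w0: "w V \<ge> 0" and g0: "g V \<ge> 0" for V
    by (simp_all add: w_def g_def)
  have K0: "K \<ge> 0"
    using \<open>n \<ge> 1\<close> by (simp add: K_def)
  have D0: "D \<ge> 0"
    unfolding D_def using fin w0 by (intro sum_nonneg local_var_nonneg) auto
  have N0: "N e b \<ge> 0" and A0: "A e b \<ge> 0" for e b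
    unfolding N_def A_def using w0 g0 by (auto intro!: side_mass_nonneg)
  have NT: "N e False + N e True = T" for e
    using side_mass_total[of S w e] by (simp add: N_def T_def)
  have zero: "A e b = 0" if "N e b = 0" for e b
  proof -
    have "\<forall>V\<in>Pow S. of_bool ((e \<in> V) = b) * w V = 0"
      using that fin w0 unfolding N_def side_mass_def
      by (subst (asm) sum_nonneg_eq_0_iff) auto
    then show ?thesis
      unfolding A_def side_mass_def by (intro sum.neutral) auto
  qed
  have ratio: "N e (\<not> b) \<le> (real n - 1) * N e b" if "e \<in> S" "N e b > 0" for e b
  proof -
    have "N e (\<not> b) \<le> (real (card S) - 1) * N e b"
      using wick_side_mass_ratio[OF wick fin that(1) unit, of b] that(2)
      unfolding N_def w_def by simp
    also have "\<dots> \<le> (real n - 1) * N e b"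
      using Suc.prems(2) that(2) by (intro mult_right_mono) auto
    finally show ?thesis .
  qed
  have E_le: "E e \<le> K * (Q e / T)" if e: "e \<in> S" for e
    unfolding E_def Q_def K_def NT[of e, symmetric]
    using ratio[OF e, of False] ratio[OF e, of True] N0 A0 zero \<open>n \<ge> 1\<close>
    by (intro two_point_log_sobolev_masses) auto
  have Q_le: "(\<Sum>e\<in>S. Q e / T) \<le> D"
  proof (cases "T = 0")
    case True
    then show ?thesis using D0 by simp
  next
    case False
    then have "T > 0"
      using sum_nonneg[of "Pow S" w] w0 by (simp add: T_def less_le)
    have "(\<Sum>e\<in>S. Q e) \<le> T * D"
      using local_var_lower_bound[OF wick fin, of f]
      unfolding Q_def N_def A_def T_def D_def w_def g_def .
    then show ?thesis
      using \<open>T > 0\<close> by (simp add: sum_divide_distrib[symmetric] field_simps)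
  qed
  have split: "mass_entropy S w g \<le> K * (\<Sum>Y\<in>Pow S. local_var (S - {e}) w f Y) + K * (Q e / T)"
    if e: "e \<in> S" for e
  proof -
    have cS: "card (S - {e}) = m" "card (S - {e}) \<le> n"
      using Suc.hyps(2) Suc.prems(2) fin e by auto
    have "mass_entropy (S - {e}) w g \<le> K * (\<Sum>Y\<in>Pow (S - {e}). local_var (S - {e}) w f Y)"
      unfolding w_def g_def K_def
      using cS fin wick_pin(1)[OF wick e] unit \<open>n \<ge> 1\<close>
      by (intro Suc.hyps(1)) auto
    moreover have "mass_entropy (S - {e}) (\<lambda>V. w (insert e V)) (\<lambda>V. g (insert e V))
        \<le> K * (\<Sum>Y\<in>Pow (S - {e}). local_var (S - {e}) (\<lambda>V. w (insert e V)) (\<lambda>V. f (insert e V)) Y)"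
    proof -
      have "(\<psi> (insert e V))\<^sup>2 \<in> {0, 1}" if "V \<subseteq> S - {e}" for V
        using unit[of "insert e V"] that e by blast
      then show ?thesis
        unfolding w_def g_def K_def
        using cS fin wick_pin(2)[OF wick e] \<open>n \<ge> 1\<close>
        by (intro Suc.hyps(1)) auto
    qed
    moreover have "mass_entropy S w g = mass_entropy (S - {e}) w g
        + mass_entropy (S - {e}) (\<lambda>V. w (insert e V)) (\<lambda>V. g (insert e V)) + E e"
      using mass_entropy_split[OF fin e, of w g] by (simp add: Let_def E_def N_def A_def)
    ultimately show ?thesis
      using E_le[OF e] unfolding sum_local_var_pin[OF fin e, symmetric] distrib_left by linarith
  qed
  have "real (card S) * mass_entropy S w g = (\<Sum>e\<in>S. mass_entropy S w g)"
    by simp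
  also have "\<dots> \<le> (\<Sum>e\<in>S. K * (\<Sum>Y\<in>Pow S. local_var (S - {e}) w f Y) + K * (Q e / T))"
    using split by (intro sum_mono) auto
  also have "\<dots> = K * ((\<Sum>Y\<in>Pow S. \<Sum>e\<in>S. local_var (S - {e}) w f Y) + (\<Sum>e\<in>S. Q e / T))"
    unfolding sum.distrib sum_distrib_left[symmetric] distrib_left[symmetric]
    by (subst sum.swap) (rule refl)
  also have "\<dots> \<le> K * ((\<Sum>Y\<in>Pow S. (real (card S) - 1) * local_var S w f Y) + D)"
    using K0 Q_le fin w0 by (intro mult_left_mono add_mono sum_mono sum_local_var_remove) auto
  also have "\<dots> = real (card S) * (K * D)"
    unfolding sum_distrib_left[symmetric] D_def[symmetric] by (simp add: algebra_simps)
  finally have calc: "real (card S) * mass_entropy S w g \<le> real (card S) * (K * D)" .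
  have "mass_entropy S w g \<le> K * D"
  proof -
    have "real (card S) > 0"
      using Suc.hyps(2) by linarith
    then show ?thesis
      using calc by (rule mult_left_le_imp_le[rotated])
  qed
  then show ?case
    by (simp add: w_def[abs_def] g_def[abs_def] K_def D_def)
qed

section \<open>The flip-repair walk\<close>

text \<open>The mean squared difference of two independent samples is twice the variance, here
  without normalisation.\<close>

lemma local_var_pairs:
  assumes fin: "finite J" and w: "\<And>V. w V \<ge> 0"
  shows "(\<Sum>i\<in>J. w (flip i Y) * ((\<Sum>j\<in>J. w (flip j Y) * (f (flip i Y) - f (flip j Y))\<^sup>2)
      / (\<Sum>j\<in>J. w (flip j Y)))) = 2 * local_var J w f Y"
proof -
  define W where "W = (\<Sum>j\<in>J. w (flip j Y))"
  define s where "s = (\<Sum>j\<in>J. w (flip j Y) * f (flip j Y))"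
  define r where "r = (\<Sum>j\<in>J. w (flip j Y) * (f (flip j Y))\<^sup>2)"
  have "(\<Sum>i\<in>J. w (flip i Y) * ((\<Sum>j\<in>J. w (flip j Y) * (f (flip i Y) - f (flip j Y))\<^sup>2) / W))
      = (\<Sum>i\<in>J. w (flip i Y) * ((f (flip i Y))\<^sup>2 * W - 2 * f (flip i Y) * s + r)) / W"
  proof -
    have "(\<Sum>j\<in>J. w (flip j Y) * (f (flip i Y) - f (flip j Y))\<^sup>2)
        = (f (flip i Y))\<^sup>2 * W - 2 * f (flip i Y) * s + r" for i
      unfolding W_def s_def r_def sum_distrib_left sum_subtractf[symmetric] sum.distrib[symmetric]
      by (intro sum.cong refl) (simp add: power2_eq_square algebra_simps)
    then show ?thesis
      by (simp add: sum_divide_distrib)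
  qed
  also have "(\<Sum>i\<in>J. w (flip i Y) * ((f (flip i Y))\<^sup>2 * W - 2 * f (flip i Y) * s + r))
      = W * r - 2 * s * s + r * W"
    unfolding r_def s_def W_def sum_distrib_left sum_distrib_right sum_subtractf[symmetric] sum.distrib[symmetric]
    by (simp add: r_def s_def W_def sum_distrib_left sum_distrib_right sum.distrib sum_subtractf algebra_simps)
  also have "(W * r - 2 * s * s + r * W) / W = 2 * local_var J w f Y"
  proof (cases "W = 0")
    case True
    then have "\<forall>j\<in>J. w (flip j Y) = 0"
      unfolding W_def using fin w by (subst (asm) sum_nonneg_eq_0_iff) auto
    then show ?thesis
      using True by (simp add: local_var_def)
  next
    case False
    then show ?thesis
      unfolding local_var_def W_def[symmetric] s_def[symmetric] r_def[symmetric]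
      by (simp add: field_simps power2_eq_square)
  qed
  finally show ?thesis
    by (simp add: W_def)
qed

section \<open>Entropy against the variance of the square root\<close>

lemma xlnx_ge:
  fixes x c :: real
  assumes "x \<ge> 0" "c > 0"
  shows "x * ln x \<ge> x * ln c + 2 * x - 2 * sqrt c * sqrt x"
proof (cases "x = 0")
  case False
  then have x: "x > 0" using assms by simp
  \<comment> \<open>The bound \<open>ln t \<le> t - 1\<close> at the square root of
    \<open>c / x\<close>; it is sharp for \<open>x = c\<close>.\<close>
  have "ln (sqrt c / sqrt x) \<le> sqrt c / sqrt x - 1"
    using x assms by (intro ln_le_minus_one) auto
  then have "ln c - ln x \<le> 2 * (sqrt c / sqrt x) - 2"
    using x assms by (simp add: ln_div ln_sqrt)
  then have "x * (ln c - ln x) \<le> x * (2 * (sqrt c / sqrt x) - 2)"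
    using x by (intro mult_left_mono) auto
  also have "x * (2 * (sqrt c / sqrt x) - 2) = 2 * sqrt c * (x / sqrt x) - 2 * x"
    by (simp add: algebra_simps)
  also have "x / sqrt x = sqrt x"
    using x by (simp add: real_div_sqrt)
  finally show ?thesis
    by (simp add: algebra_simps)
qed simp

text \<open>\<open>xlnx_ge\<close> with \<open>c\<close> the mean, summed with the weights. What is
  left over beyond the variance of the square root is the square of
  \<open>sqrt s - r / sqrt W\<close>.\<close>

lemma entropy_ge_variance:
  fixes v x :: "'a \<Rightarrow> real"
  assumes fin: "finite J" and v: "\<And>j. j \<in> J \<Longrightarrow> v j \<ge> 0" and x: "\<And>j. j \<in> J \<Longrightarrow> x j \<ge> 0"
  shows "(\<Sum>j\<in>J. v j * x j) - (\<Sum>j\<in>J. v j * sqrt (x j))\<^sup>2 / (\<Sum>j\<in>J. v j)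
    \<le> (\<Sum>j\<in>J. v j * (x j * ln (x j))) - (\<Sum>j\<in>J. v j * x j) * ln ((\<Sum>j\<in>J. v j * x j) / (\<Sum>j\<in>J. v j))"
proof -
  define W where "W = (\<Sum>j\<in>J. v j)"
  define s where "s = (\<Sum>j\<in>J. v j * x j)"
  define r where "r = (\<Sum>j\<in>J. v j * sqrt (x j))"
  have s0: "s \<ge> 0" and W0: "W \<ge> 0"
    unfolding s_def W_def using v x by (auto intro!: sum_nonneg)
  show ?thesis
  proof (cases "s = 0")
    case True
    then have "\<forall>j\<in>J. v j * x j = 0"
      unfolding s_def using fin v x by (subst (asm) sum_nonneg_eq_0_iff) auto
    then have "(\<Sum>j\<in>J. v j * sqrt (x j)) = 0" "(\<Sum>j\<in>J. v j * (x j * ln (x j))) = 0"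
      by (auto intro!: sum.neutral)
    then show ?thesis
      using True by (simp add: s_def)
  next
    case False
    have "W \<noteq> 0"
    proof
      assume "W = 0"
      then have "\<forall>j\<in>J. v j = 0"
        unfolding W_def using fin v by (subst (asm) sum_nonneg_eq_0_iff) auto
      then show False using False by (simp add: s_def)
    qed
    then have W: "W > 0" and c: "s / W > 0"
      using W0 s0 False by auto
    have "(\<Sum>j\<in>J. v j * (x j * ln (s / W) + 2 * x j - 2 * sqrt (s / W) * sqrt (x j)))
        \<le> (\<Sum>j\<in>J. v j * (x j * ln (x j)))"
      using v x xlnx_ge[OF _ c] by (intro sum_mono mult_left_mono) auto
    moreover have "(\<Sum>j\<in>J. v j * (x j * ln (s / W) + 2 * x j - 2 * sqrt (s / W) * sqrt (x j)))
        = s * ln (s / W) + 2 * s - 2 * sqrt (s / W) * r"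
      unfolding s_def r_def sum_distrib_left sum_distrib_right sum_subtractf[symmetric] sum.distrib[symmetric]
      by (intro sum.cong refl) (simp add: algebra_simps)
    moreover have "0 \<le> s - 2 * sqrt (s / W) * r + r\<^sup>2 / W"
    proof -
      have "(sqrt s - r / sqrt W)\<^sup>2 = s - 2 * sqrt (s / W) * r + r\<^sup>2 / W"
        using s0 W by (simp add: power2_diff power_divide real_sqrt_divide)
      then show ?thesis by (metis zero_le_power2)
    qed
    ultimately show ?thesis
      unfolding s_def[symmetric] r_def[symmetric] W_def[symmetric] by linarith
  qed
qed

text \<open>Each directed edge of the hypercube is recounted from its other endpoint. Applied with
  weights, this carries the reversibility of the walk between states and intermediate sets.\<close>

lemma sum_edges:
  "(\<Sum>x\<in>Pow I. \<Sum>i\<in>I. G x (flip i x)) = (\<Sum>Y\<in>Pow I. \<Sum>i\<in>I. G (flip i Y) Y)"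
proof -
  have "(\<Sum>x\<in>Pow I. \<Sum>i\<in>I. G x (flip i x)) = (\<Sum>i\<in>I. \<Sum>x\<in>Pow I. G x (flip i x))"
    by (rule sum.swap)
  also have "\<dots> = (\<Sum>i\<in>I. \<Sum>Y\<in>Pow I. G (flip i Y) Y)"
  proof (rule sum.cong[OF refl])
    fix i assume "i \<in> I"
    then show "(\<Sum>x\<in>Pow I. G x (flip i x)) = (\<Sum>Y\<in>Pow I. G (flip i Y) Y)"
      using sum_Pow_flip[of i I "\<lambda>x. G x (flip i x)"] by simp
  qed
  also have "\<dots> = (\<Sum>Y\<in>Pow I. \<Sum>i\<in>I. G (flip i Y) Y)"
    by (rule sum.swap)
  finally show ?thesis .
qed

lemma sum_neighbours:
  assumes fin: "finite I" and Y: "Y \<subseteq> I"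
  shows "(\<Sum>T\<in>Pow I. if card (sym_diff T Y) = 1 then G T else (0 :: real)) = (\<Sum>j\<in>I. G (flip j Y))"
proof -
  have inj: "inj_on (\<lambda>j. flip j Y) I"
    by (rule inj_onI) (metis mem_flip)
  have "(\<Sum>T\<in>Pow I. if card (sym_diff T Y) = 1 then G T else 0) = (\<Sum>T\<in>(\<lambda>j. flip j Y) ` I. G T)"
  proof (rule sum.mono_neutral_cong_right)
    show "finite (Pow I)" using fin by simp
    show "(\<lambda>j. flip j Y) ` I \<subseteq> Pow I"
      using Y by (auto simp: flip_subset)
    show "\<forall>T\<in>Pow I - (\<lambda>j. flip j Y) ` I. (if card (sym_diff T Y) = 1 then G T else 0) = 0"
    proof
      fix T assume T: "T \<in> Pow I - (\<lambda>j. flip j Y) ` I"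
      have "card (sym_diff T Y) \<noteq> 1"
      proof
        assume "card (sym_diff T Y) = 1"
        then obtain j where j: "sym_diff T Y = {j}"
          by (auto simp: card_1_singleton_iff)
        then have "T = flip j Y"
          by (auto simp: set_eq_iff)
        moreover have "j \<in> I"
          using j T Y by auto
        ultimately show False using T by auto
      qed
      then show "(if card (sym_diff T Y) = 1 then G T else 0) = 0" by simp
    qed
    fix T assume "T \<in> (\<lambda>j. flip j Y) ` I"
    then obtain j where "T = flip j Y" by auto
    then have "sym_diff T Y = {j}"
      by (auto simp: set_eq_iff)
    then show "(if card (sym_diff T Y) = 1 then G T else 0) = G T" by simp
  qed
  also have "\<dots> = (\<Sum>j\<in>I. G (flip j Y))"
    using sum.reindex[OF inj] by simp
  finally show ?thesis .
qed

text \<open>Inside the locale the matrix enters only through a square root \<open>\<psi>\<close> of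
  its minors that satisfies the Wick relations. The assumption \<open>empty\<close> keeps the
  partition sum at least 1.\<close>

locale unit_minors =
  fixes n :: nat and A :: "real mat" and \<psi> :: "nat set \<Rightarrow> real"
  assumes n2: "2 \<le> n"
    and weight: "\<And>S. S \<subseteq> {0..<n} \<Longrightarrow> minor_weight A S = (\<psi> S)\<^sup>2"
    and unit: "\<And>S. S \<subseteq> {0..<n} \<Longrightarrow> (\<psi> S)\<^sup>2 \<in> {0, 1}"
    and empty: "\<psi> {} = 1"
    and wick: "wick {0..<n} \<psi>"
begin

definition w :: "nat set \<Rightarrow> real" where "w V = (\<psi> V)\<^sup>2"

abbreviation I :: "nat set" where "I \<equiv> {0..<n}"

definition Z :: real where "Z = (\<Sum>V\<in>Pow I. w V)"

definition K :: real where "K = ln (real n) + 2"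

definition W :: "nat set \<Rightarrow> real" where "W Y = (\<Sum>j\<in>I. w (flip j Y))"

lemma w_nonneg: "w V \<ge> 0"
  by (simp add: w_def)

lemma W_nonneg: "W Y \<ge> 0"
  unfolding W_def by (intro sum_nonneg w_nonneg)

lemma Z_ge_1: "Z \<ge> 1"
proof -
  have "w {} \<le> Z"
    unfolding Z_def by (intro member_le_sum) (auto simp: w_nonneg)
  then show ?thesis by (simp add: w_def empty)
qed

lemma Z_le: "Z \<le> 2 ^ n"
proof -
  have "Z \<le> (\<Sum>V\<in>Pow I. 1)"
    unfolding Z_def
  proof (rule sum_mono)
    fix V assume "V \<in> Pow I"
    then show "w V \<le> 1" using unit[of V] by (auto simp: w_def)
  qed
  then show ?thesis by (simp add: card_Pow)
qed

lemma K_ge: "K \<ge> 2"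
  using n2 by (simp add: K_def)

lemma states_iff: "V \<in> states n A \<longleftrightarrow> V \<subseteq> I \<and> w V = 1"
  using unit[of V] weight[of V] by (auto simp: states_def w_def)

lemma partition_sum_eq: "partition_sum n A = Z"
  unfolding partition_sum_def Z_def by (intro sum.cong) (auto simp: weight w_def)

lemma minor_measure_eq: "V \<in> states n A \<Longrightarrow> minor_measure n A V = 1 / Z"
  using weight[of V] by (simp add: minor_measure_def partition_sum_eq states_iff w_def)

lemma sum_states: "(\<Sum>V\<in>states n A. h V) = (\<Sum>V\<in>Pow I. w V * h V)"
proof -
  have "w V = 0" if "V \<in> Pow I - states n A" for V
    using unit[of V] that by (auto simp: states_iff w_def)
  moreover have "states n A \<subseteq> Pow I"
    using states_iff by blast
  ultimately show ?thesis
    by (intro sum.mono_neutral_cong_left) (auto simp: states_iff)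
qed

lemma repair_eq:
  assumes "Y \<subseteq> I" "T \<in> states n A"
  shows "repair n A Y T = (if card (sym_diff T Y) = 1 then 1 / W Y else 0)"
proof -
  have "(\<Sum>j\<in>I. minor_weight A (sym_diff Y {j})) = W Y"
    unfolding W_def
  proof (intro sum.cong refl)
    fix j assume "j \<in> I"
    then have "flip j Y \<subseteq> I" using assms by (simp add: flip_subset)
    then show "minor_weight A (sym_diff Y {j}) = w (flip j Y)"
      using weight[of "flip j Y"] by (simp add: w_def flip_def)
  qed
  moreover have "minor_weight A T = 1"
    using assms weight[of T] by (simp add: states_iff w_def)
  ultimately show ?thesis
    using assms by (simp add: repair_def)
qed

lemma sum_repair:
  assumes Y: "Y \<subseteq> I"
  shows "(\<Sum>T\<in>states n A. repair n A Y T * h T) = (\<Sum>j\<in>I. w (flip j Y) * h (flip j Y)) / W Y"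
proof -
  have "(\<Sum>T\<in>states n A. repair n A Y T * h T)
      = (\<Sum>T\<in>states n A. if card (sym_diff T Y) = 1 then h T / W Y else 0)"
    by (intro sum.cong refl) (simp add: repair_eq[OF Y])
  also have "\<dots> = (\<Sum>T\<in>Pow I. if card (sym_diff T Y) = 1 then w T * h T / W Y else 0)"
    unfolding sum_states by (intro sum.cong refl) simp
  also have "\<dots> = (\<Sum>j\<in>I. w (flip j Y) * h (flip j Y) / W Y)"
    by (rule sum_neighbours[OF _ Y]) simp
  finally show ?thesis
    by (simp add: sum_divide_distrib)
qed

lemma entropy_eq: "entropy (states n A) (minor_measure n A) g = mass_entropy I w g / Z"
proof -
  have "expect (states n A) (minor_measure n A) h = (\<Sum>V\<in>Pow I. w V * h V) / Z" for h
  proof -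
    have "expect (states n A) (minor_measure n A) h = (\<Sum>V\<in>states n A. h V / Z)"
      unfolding expect_def by (intro sum.cong refl) (simp add: minor_measure_eq)
    then show ?thesis
      by (simp add: sum_states sum_divide_distrib)
  qed
  then show ?thesis
    unfolding entropy_def mass_entropy_def Z_def[symmetric] by (simp add: diff_divide_distrib)
qed

text \<open>Grouping the transitions by the intermediate set \<open>Y\<close> produces the pair sums
  of \<open>local_var_pairs\<close>, whose factor 2 cancels the 1/2 of the Dirichlet form.\<close>

lemma dirichlet_form_eq:
  "dirichlet_form (states n A) (minor_measure n A) (flip_repair n A) f
    = (\<Sum>Y\<in>Pow I. local_var I w f Y) / (real n * Z)"
proof -
  define H where "H x Y = (\<Sum>j\<in>I. w (flip j Y) * (f x - f (flip j Y))\<^sup>2) / W Y" for x Y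
  have step: "(\<Sum>y\<in>states n A. minor_measure n A x * flip_repair n A x y * (f x - f y)\<^sup>2)
      = (\<Sum>i\<in>I. H x (flip i x)) / (real n * Z)" if x: "x \<in> states n A" for x
  proof -
    have xI: "x \<subseteq> I" using x by (simp add: states_iff)
    have "(\<Sum>y\<in>states n A. minor_measure n A x * flip_repair n A x y * (f x - f y)\<^sup>2)
        = (\<Sum>y\<in>states n A. \<Sum>i\<in>I. (repair n A (flip i x) y * (f x - f y)\<^sup>2) / (real n * Z))"
      unfolding flip_repair_def minor_measure_eq[OF x] sum_distrib_left sum_distrib_right
      by (intro sum.cong refl) (simp add: flip_def mult_ac)
    also have "\<dots> = (\<Sum>i\<in>I. \<Sum>y\<in>states n A. (repair n A (flip i x) y * (f x - f y)\<^sup>2) / (real n * Z))"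
      by (rule sum.swap)
    also have "\<dots> = (\<Sum>i\<in>I. H x (flip i x) / (real n * Z))"
      unfolding sum_divide_distrib[symmetric]
    proof (intro sum.cong refl arg_cong2[of _ _ _ _ "(/)"])
      fix i assume "i \<in> I"
      then have "flip i x \<subseteq> I" using xI by (simp add: flip_subset)
      then show "(\<Sum>y\<in>states n A. repair n A (flip i x) y * (f x - f y)\<^sup>2) = H x (flip i x)"
        unfolding H_def by (rule sum_repair)
    qed
    finally show ?thesis by (simp add: sum_divide_distrib)
  qed
  have "(\<Sum>x\<in>states n A. \<Sum>y\<in>states n A. minor_measure n A x * flip_repair n A x y * (f x - f y)\<^sup>2)
      = (\<Sum>x\<in>states n A. (\<Sum>i\<in>I. H x (flip i x)) / (real n * Z))"
    by (intro sum.cong refl step)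
  also have "\<dots> = (\<Sum>x\<in>Pow I. \<Sum>i\<in>I. w x * H x (flip i x)) / (real n * Z)"
    unfolding sum_states by (simp add: sum_divide_distrib sum_distrib_left)
  also have "(\<Sum>x\<in>Pow I. \<Sum>i\<in>I. w x * H x (flip i x)) = (\<Sum>Y\<in>Pow I. \<Sum>i\<in>I. w (flip i Y) * H (flip i Y) Y)"
    by (rule sum_edges)
  also have "\<dots> = (\<Sum>Y\<in>Pow I. 2 * local_var I w f Y)"
    unfolding H_def W_def by (intro sum.cong refl local_var_pairs w_nonneg) simp
  finally show ?thesis
    unfolding dirichlet_form_def by (simp add: sum_distrib_left[symmetric])
qed

lemma mass_entropy_le: "mass_entropy I w (\<lambda>V. (f V)\<^sup>2) \<le> K * (\<Sum>Y\<in>Pow I. local_var I w f Y)"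
  unfolding w_def[abs_def] K_def using n2 unit wick by (intro log_sobolev_masses) auto

theorem log_sobolev:
  "entropy (states n A) (minor_measure n A) (\<lambda>S. (f S)\<^sup>2)
    \<le> real n * (ln (real n) + 2) *
       dirichlet_form (states n A) (minor_measure n A) (flip_repair n A) f"
proof -
  have "mass_entropy I w (\<lambda>V. (f V)\<^sup>2) / Z \<le> K * (\<Sum>Y\<in>Pow I. local_var I w f Y) / Z"
    using mass_entropy_le Z_ge_1 by (intro divide_right_mono) auto
  then show ?thesis
    using n2 unfolding entropy_eq dirichlet_form_eq K_def by simp
qed

section \<open>Entropy decay in one step\<close>

definition mean_at :: "(nat set \<Rightarrow> real) \<Rightarrow> nat set \<Rightarrow> real" where
  "mean_at g Y = (\<Sum>j\<in>I. w (flip j Y) * g (flip j Y)) / W Y"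

text \<open>One step of the walk acting on functions: \<open>mean_at\<close> averages over the
  repair, the outer sum over the flip. By reversibility the same operator moves densities with
  respect to the stationary measure (\<open>density_Suc\<close>).\<close>

definition evolve :: "(nat set \<Rightarrow> real) \<Rightarrow> nat set \<Rightarrow> real" where
  "evolve g T = (\<Sum>j\<in>I. mean_at g (flip j T)) / real n"

definition ent :: "(nat set \<Rightarrow> real) \<Rightarrow> real" where
  "ent g = (\<Sum>V\<in>Pow I. w V * (g V * ln (g V)))"

lemma W_zero: "W Y = 0 \<Longrightarrow> j \<in> I \<Longrightarrow> w (flip j Y) = 0"
  unfolding W_def by (subst (asm) sum_nonneg_eq_0_iff) (auto simp: w_nonneg)

lemma W_mean_at: "W Y * mean_at g Y = (\<Sum>j\<in>I. w (flip j Y) * g (flip j Y))"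
  using W_zero[of Y] by (cases "W Y = 0") (auto simp: mean_at_def intro!: sum.neutral[symmetric])

lemma mean_at_nonneg: "(\<And>V. V \<subseteq> I \<Longrightarrow> g V \<ge> 0) \<Longrightarrow> Y \<subseteq> I \<Longrightarrow> mean_at g Y \<ge> 0"
  unfolding mean_at_def
  by (intro divide_nonneg_nonneg sum_nonneg mult_nonneg_nonneg w_nonneg W_nonneg) (auto simp: flip_subset)

lemma sum_evolve: "(\<Sum>V\<in>Pow I. w V * evolve g V) = (\<Sum>V\<in>Pow I. w V * g V)"
proof -
  have "(\<Sum>V\<in>Pow I. w V * evolve g V) = (\<Sum>V\<in>Pow I. \<Sum>j\<in>I. w V * mean_at g (flip j V)) / real n"
    unfolding evolve_def by (simp add: sum_divide_distrib sum_distrib_left)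
  also have "(\<Sum>V\<in>Pow I. \<Sum>j\<in>I. w V * mean_at g (flip j V)) = (\<Sum>Y\<in>Pow I. \<Sum>j\<in>I. w (flip j Y) * mean_at g Y)"
    by (rule sum_edges)
  also have "\<dots> = (\<Sum>Y\<in>Pow I. \<Sum>j\<in>I. w (flip j Y) * g (flip j Y))"
    unfolding sum_distrib_right[symmetric] W_def[symmetric] W_mean_at ..
  also have "\<dots> = (\<Sum>V\<in>Pow I. \<Sum>j\<in>I. w V * g V)"
    by (rule sum_edges[of "\<lambda>x y. w x * g x", symmetric])
  also have "\<dots> = real n * (\<Sum>V\<in>Pow I. w V * g V)"
    by (simp add: sum_distrib_left)
  finally show ?thesis using n2 by simp
qed

text \<open>Passing to \<open>mean_at\<close> loses the local entropy at each \<open>Y\<close>,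
  which dominates the local variance of \<open>sqrt g\<close> by \<open>entropy_ge_variance\<close>;
  these variances sum to at least \<open>ent g / K\<close> by the logarithmic Sobolev inequality for
  \<open>sqrt g\<close>. Averaging over the flip does not increase the entropy, by
  convexity.\<close>

lemma ent_evolve:
  assumes g: "\<And>V. V \<subseteq> I \<Longrightarrow> g V \<ge> 0" and total: "(\<Sum>V\<in>Pow I. w V * g V) = Z"
  shows "ent (evolve g) \<le> (1 - 1 / (real n * K)) * ent g"
proof -
  define k where "k x = x * ln x" for x :: real
  have k_evolve: "k (evolve g T) \<le> (\<Sum>j\<in>I. k (mean_at g (flip j T))) / real n" if T: "T \<subseteq> I" for T
  proof -
    have m0: "mean_at g (flip j T) \<ge> 0" if "j \<in> I" for j
      using that T g by (intro mean_at_nonneg) (auto simp: flip_subset)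
    define x where "x j = mean_at g (flip j T)" for j
    have x0: "\<And>j. j \<in> I \<Longrightarrow> x j \<ge> 0" using m0 by (simp add: x_def)
    \<comment> \<open>Jensen's inequality for \<open>x * ln x\<close> is drawn from
      \<open>entropy_ge_variance\<close> with unit weights, since the variance there is nonnegative
      by Cauchy-Schwarz.\<close>
    have "(\<Sum>j\<in>I. 1 * sqrt (x j))\<^sup>2 \<le> (\<Sum>j\<in>I. 1\<^sup>2) * (\<Sum>j\<in>I. (sqrt (x j))\<^sup>2)"
      by (rule Cauchy_Schwarz_ineq_sum)
    then have "(\<Sum>j\<in>I. sqrt (x j))\<^sup>2 \<le> real n * (\<Sum>j\<in>I. x j)"
      using x0 by simp
    then have "0 \<le> (\<Sum>j\<in>I. x j) - (\<Sum>j\<in>I. sqrt (x j))\<^sup>2 / real n"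
      using n2 by (simp add: field_simps)
    also have "\<dots> \<le> (\<Sum>j\<in>I. x j * ln (x j)) - (\<Sum>j\<in>I. x j) * ln ((\<Sum>j\<in>I. x j) / real n)"
      using entropy_ge_variance[of I "\<lambda>_. 1" x] x0 by simp
    finally have "(\<Sum>j\<in>I. x j) * ln ((\<Sum>j\<in>I. x j) / real n) / real n \<le> (\<Sum>j\<in>I. x j * ln (x j)) / real n"
      using n2 by (intro divide_right_mono) auto
    then show ?thesis
      by (simp add: k_def evolve_def x_def)
  qed
  have "real n * ent (evolve g) \<le> real n * (\<Sum>T\<in>Pow I. w T * ((\<Sum>j\<in>I. k (mean_at g (flip j T))) / real n))"
    unfolding ent_def k_def[symmetric] using k_evolve w_nonneg
    by (intro mult_left_mono sum_mono) auto
  also have "\<dots> = (\<Sum>T\<in>Pow I. \<Sum>j\<in>I. w T * k (mean_at g (flip j T)))"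
  proof -
    have cancel: "real n * (\<Sum>T\<in>Pow I. w T * (s T / real n)) = (\<Sum>T\<in>Pow I. w T * s T)" for s
      unfolding sum_distrib_left using n2 by (intro sum.cong refl) simp
    show ?thesis
      unfolding cancel by (simp only: sum_distrib_left)
  qed
  also have "\<dots> = (\<Sum>Y\<in>Pow I. \<Sum>j\<in>I. w (flip j Y) * k (mean_at g Y))"
    by (rule sum_edges)
  also have "\<dots> = (\<Sum>Y\<in>Pow I. W Y * k (mean_at g Y))"
    by (simp add: W_def sum_distrib_right)
  finally have upper: "real n * ent (evolve g) \<le> (\<Sum>Y\<in>Pow I. W Y * k (mean_at g Y))" .
  have "real n * ent g = (\<Sum>T\<in>Pow I. \<Sum>j\<in>I. w T * k (g T))"
    by (simp add: ent_def k_def sum_distrib_left)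
  also have "\<dots> = (\<Sum>Y\<in>Pow I. \<Sum>j\<in>I. w (flip j Y) * k (g (flip j Y)))"
    by (rule sum_edges)
  finally have lower: "real n * ent g = (\<Sum>Y\<in>Pow I. \<Sum>j\<in>I. w (flip j Y) * k (g (flip j Y)))" .
  have "local_var I w (\<lambda>V. sqrt (g V)) Y \<le> (\<Sum>j\<in>I. w (flip j Y) * k (g (flip j Y))) - W Y * k (mean_at g Y)"
    if Y: "Y \<subseteq> I" for Y
  proof -
    have g0: "g (flip j Y) \<ge> 0" if "j \<in> I" for j
      using that Y g by (auto simp: flip_subset)
    have "local_var I w (\<lambda>V. sqrt (g V)) Y
        = (\<Sum>j\<in>I. w (flip j Y) * g (flip j Y)) - (\<Sum>j\<in>I. w (flip j Y) * sqrt (g (flip j Y)))\<^sup>2 / (\<Sum>j\<in>I. w (flip j Y))"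
      using g0 by (simp add: local_var_def)
    also have "\<dots> \<le> (\<Sum>j\<in>I. w (flip j Y) * (g (flip j Y) * ln (g (flip j Y))))
        - (\<Sum>j\<in>I. w (flip j Y) * g (flip j Y)) * ln ((\<Sum>j\<in>I. w (flip j Y) * g (flip j Y)) / (\<Sum>j\<in>I. w (flip j Y)))"
      using g0 w_nonneg by (intro entropy_ge_variance) auto
    also have "(\<Sum>j\<in>I. w (flip j Y) * g (flip j Y)) * ln ((\<Sum>j\<in>I. w (flip j Y) * g (flip j Y)) / (\<Sum>j\<in>I. w (flip j Y)))
        = W Y * k (mean_at g Y)"
      unfolding W_def[symmetric] k_def mult.assoc[symmetric] W_mean_at by (simp add: mean_at_def)
    finally show ?thesis by (simp add: k_def)
  qed
  then have "(\<Sum>Y\<in>Pow I. local_var I w (\<lambda>V. sqrt (g V)) Y)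
      \<le> (\<Sum>Y\<in>Pow I. (\<Sum>j\<in>I. w (flip j Y) * k (g (flip j Y))) - W Y * k (mean_at g Y))"
    by (intro sum_mono) simp
  then have gain: "(\<Sum>Y\<in>Pow I. local_var I w (\<lambda>V. sqrt (g V)) Y) \<le> real n * ent g - real n * ent (evolve g)"
    using upper unfolding lower sum_subtractf by linarith
  \<comment> \<open>By \<open>total\<close> the mean of \<open>g\<close> is 1, so the term with the
    logarithm of the mean drops out.\<close>
  have "ent g = mass_entropy I w (\<lambda>V. (sqrt (g V))\<^sup>2)"
  proof -
    have "(\<Sum>V\<in>Pow I. w V * ((sqrt (g V))\<^sup>2 * ln ((sqrt (g V))\<^sup>2))) = (\<Sum>V\<in>Pow I. w V * (g V * ln (g V)))"
      "(\<Sum>V\<in>Pow I. w V * (sqrt (g V))\<^sup>2) = (\<Sum>V\<in>Pow I. w V * g V)"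
      using g by (auto intro!: sum.cong)
    then show ?thesis
      using Z_ge_1 by (simp add: mass_entropy_def total Z_def[symmetric] ent_def)
  qed
  then have "ent g \<le> K * (\<Sum>Y\<in>Pow I. local_var I w (\<lambda>V. sqrt (g V)) Y)"
    using mass_entropy_le[of "\<lambda>V. sqrt (g V)"] by simp
  also have "\<dots> \<le> K * (real n * ent g - real n * ent (evolve g))"
    using gain K_ge by (intro mult_left_mono) auto
  finally have "ent g \<le> K * (real n * ent g - real n * ent (evolve g))" .
  then show ?thesis
    using K_ge n2 by (simp add: field_simps)
qed

section \<open>The law at time \<open>t\<close> and its distance from equilibrium\<close>

definition density :: "nat set \<Rightarrow> nat \<Rightarrow> nat set \<Rightarrow> real" where
  "density S t T = Z * kernel_power (states n A) (flip_repair n A) t S T"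

text \<open>Adjacency of \<open>T\<close> and \<open>Y\<close> is symmetric, and
  \<open>repair\<close> from \<open>Y\<close> takes the same value \<open>1 / W Y\<close> at all
  neighbouring states. Moving the sum to the intermediate sets therefore yields
  \<open>mean_at\<close>.\<close>

lemma density_Suc:
  assumes T: "T \<in> states n A"
  shows "density S (Suc t) T = evolve (density S t) T"
proof -
  define g where "g = density S t"
  have TI: "T \<subseteq> I" using T by (simp add: states_iff)
  have "density S (Suc t) T = (\<Sum>z\<in>states n A. g z * flip_repair n A z T)"
    by (simp add: density_def g_def sum_distrib_left mult.assoc)
  also have "\<dots> = (\<Sum>z\<in>Pow I. \<Sum>i\<in>I. w z * g z * repair n A (flip i z) T / real n)"
    unfolding sum_states flip_repair_def by (simp add: sum_distrib_left flip_def mult.assoc)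
  also have "\<dots> = (\<Sum>Y\<in>Pow I. \<Sum>i\<in>I. w (flip i Y) * g (flip i Y) * repair n A Y T / real n)"
    by (rule sum_edges)
  also have "\<dots> = (\<Sum>Y\<in>Pow I. if card (sym_diff Y T) = 1 then mean_at g Y / real n else 0)"
  proof (intro sum.cong refl)
    fix Y assume "Y \<in> Pow I"
    then have r: "repair n A Y T = (if card (sym_diff Y T) = 1 then 1 / W Y else 0)"
      using repair_eq[of Y T] T by (simp add: Un_commute)
    have "(\<Sum>i\<in>I. w (flip i Y) * g (flip i Y) * repair n A Y T / real n)
        = (\<Sum>i\<in>I. w (flip i Y) * g (flip i Y)) * repair n A Y T / real n"
      by (simp add: sum_distrib_right sum_divide_distrib)
    then show "(\<Sum>i\<in>I. w (flip i Y) * g (flip i Y) * repair n A Y T / real n)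
        = (if card (sym_diff Y T) = 1 then mean_at g Y / real n else 0)"
      by (simp add: r mean_at_def)
  qed
  also have "\<dots> = (\<Sum>j\<in>I. mean_at g (flip j T) / real n)"
    by (rule sum_neighbours[OF _ TI]) simp
  finally show ?thesis
    by (simp add: evolve_def g_def sum_divide_distrib)
qed

lemma density_invariants:
  assumes S: "S \<in> states n A"
  shows "(\<forall>V\<subseteq>I. density S t V \<ge> 0) \<and> (\<Sum>V\<in>Pow I. w V * density S t V) = Z
    \<and> ent (density S t) \<le> (1 - 1 / (real n * K)) ^ t * (Z * ln Z)"
proof (induction t)
  case 0
  \<comment> \<open>The point mass at \<open>S\<close> has density \<open>Z\<close> there and 0
    elsewhere, hence entropy \<open>Z * ln Z\<close>.\<close>
  have SI: "S \<in> Pow I" and wS: "w S = 1" using S by (auto simp: states_iff)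
  have d0: "density S 0 V = (if V = S then Z else 0)" for V
    by (simp add: density_def)
  have "(\<Sum>V\<in>Pow I. w V * density S 0 V) = (\<Sum>V\<in>Pow I. if V = S then Z else 0)"
    using wS by (intro sum.cong) (auto simp: d0)
  moreover have "ent (density S 0) = (\<Sum>V\<in>Pow I. if V = S then Z * ln Z else 0)"
    unfolding ent_def using wS by (intro sum.cong) (auto simp: d0)
  moreover have "density S 0 V \<ge> 0" for V
    using Z_ge_1 by (simp add: d0)
  ultimately show ?case
    using SI by simp
next
  case (Suc t)
  define g where "g = density S t"
  have g: "\<And>V. V \<subseteq> I \<Longrightarrow> g V \<ge> 0" and total: "(\<Sum>V\<in>Pow I. w V * g V) = Z"
    and IH: "ent g \<le> (1 - 1 / (real n * K)) ^ t * (Z * ln Z)"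
    using Suc.IH by (auto simp: g_def)
  \<comment> \<open>\<open>density_Suc\<close> speaks of states only; on all other sets the weight 0
    hides the difference.\<close>
  have eq: "w V * h (density S (Suc t) V) = w V * h (evolve g V)" if "V \<in> Pow I" for V h
  proof (cases "w V = 0")
    case False
    then have "w V = 1" using unit[of V] that by (auto simp: w_def)
    then show ?thesis using that density_Suc[of V S t] by (simp add: states_iff g_def)
  qed simp
  have "density S (Suc t) V \<ge> 0" if "V \<subseteq> I" for V
  proof -
    have "flip_repair n A z V \<ge> 0" if "z \<subseteq> I" for z
      unfolding flip_repair_def
    proof (intro sum_nonneg mult_nonneg_nonneg)
      fix i assume "i \<in> I"
      then have "flip i z \<subseteq> I" using that by (simp add: flip_subset)
      then show "repair n A (sym_diff z {i}) V \<ge> 0"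
        using repair_eq[of "flip i z" V] W_nonneg
        by (cases "V \<in> states n A") (auto simp: flip_def repair_def)
    qed simp
    moreover have "density S (Suc t) V = (\<Sum>z\<in>states n A. g z * flip_repair n A z V)"
      by (simp add: density_def g_def sum_distrib_left mult.assoc)
    ultimately show ?thesis
      using g by (auto simp: states_iff intro!: sum_nonneg)
  qed
  moreover have "(\<Sum>V\<in>Pow I. w V * density S (Suc t) V) = Z"
  proof -
    have "(\<Sum>V\<in>Pow I. w V * density S (Suc t) V) = (\<Sum>V\<in>Pow I. w V * evolve g V)"
      by (intro sum.cong refl eq[where h = "\<lambda>x. x"])
    then show ?thesis
      by (simp only: sum_evolve total)
  qed
  moreover have "ent (density S (Suc t)) = ent (evolve g)"
    unfolding ent_def by (intro sum.cong refl eq[where h = "\<lambda>x. x * ln x"])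
  moreover have "ent (evolve g) \<le> (1 - 1 / (real n * K)) ^ Suc t * (Z * ln Z)"
  proof -
    have "real n * K \<ge> 1 * 1"
      using n2 K_ge by (intro mult_mono) auto
    then have "1 - 1 / (real n * K) \<ge> 0" by simp
    then have "(1 - 1 / (real n * K)) * ent g \<le> (1 - 1 / (real n * K)) * ((1 - 1 / (real n * K)) ^ t * (Z * ln Z))"
      using IH by (intro mult_left_mono)
    then show ?thesis
      using ent_evolve[OF g total] by (simp add: mult.assoc)
  qed
  ultimately show ?case by simp
qed

text \<open>A Pinsker-type bound through the Hellinger distance: \<open>g - 1\<close> factors as
  \<open>(sqrt g - 1) * (sqrt g + 1)\<close>, Cauchy-Schwarz gives the factors
  \<open>2 * Z - 2 * r\<close> and \<open>2 * Z + 2 * r\<close>, and the first is at most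
  \<open>ent g\<close> by \<open>xlnx_ge\<close> with \<open>c = 1\<close>.\<close>

lemma tv_dist_square:
  assumes S: "S \<in> states n A"
  shows "(tv_dist (states n A) (kernel_power (states n A) (flip_repair n A) t S) (minor_measure n A))\<^sup>2
    \<le> (1 - 1 / (real n * K)) ^ t * ln Z"
proof -
  define g where "g = density S t"
  have g: "\<And>V. V \<subseteq> I \<Longrightarrow> g V \<ge> 0" and total: "(\<Sum>V\<in>Pow I. w V * g V) = Z"
    and ent: "ent g \<le> (1 - 1 / (real n * K)) ^ t * (Z * ln Z)"
    using density_invariants[OF S, of t] by (auto simp: g_def)
  have Z: "Z > 0" using Z_ge_1 by simp
  define r where "r = (\<Sum>V\<in>Pow I. w V * sqrt (g V))"
  define d where "d = (\<Sum>V\<in>Pow I. w V * \<bar>g V - 1\<bar>)"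
  have "tv_dist (states n A) (kernel_power (states n A) (flip_repair n A) t S) (minor_measure n A)
      = (1 / 2) * (\<Sum>V\<in>states n A. \<bar>g V - 1\<bar> / Z)"
  proof -
    have "\<bar>kernel_power (states n A) (flip_repair n A) t S V - minor_measure n A V\<bar> = \<bar>g V - 1\<bar> / Z"
      if "V \<in> states n A" for V
    proof -
      have "kernel_power (states n A) (flip_repair n A) t S V - minor_measure n A V = (g V - 1) / Z"
        using Z that by (simp add: g_def density_def minor_measure_eq field_simps)
      then show ?thesis using Z by simp
    qed
    then show ?thesis
      unfolding tv_dist_def by simp
  qed
  also have "\<dots> = d / (2 * Z)"
    by (simp add: sum_states d_def sum_divide_distrib mult.commute)
  finally have tv: "tv_dist (states n A) (kernel_power (states n A) (flip_repair n A) t S) (minor_measure n A)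
      = d / (2 * Z)" .
  have sq: "(sqrt (g V))\<^sup>2 = g V" if "V \<in> Pow I" for V
    using g that by simp
  have "d = (\<Sum>V\<in>Pow I. (sqrt (w V) * \<bar>sqrt (g V) - 1\<bar>) * (sqrt (w V) * (sqrt (g V) + 1)))"
    unfolding d_def
  proof (intro sum.cong refl)
    fix V assume V: "V \<in> Pow I"
    have "g V - 1 = (sqrt (g V) - 1) * (sqrt (g V) + 1)"
      using sq[OF V] by (simp add: power2_eq_square algebra_simps)
    moreover have "sqrt (g V) + 1 \<ge> 0" using g V by (simp add: add_nonneg_nonneg)
    ultimately have abs: "\<bar>g V - 1\<bar> = \<bar>sqrt (g V) - 1\<bar> * (sqrt (g V) + 1)"
      by (simp add: abs_mult)
    have root: "w V = sqrt (w V) * sqrt (w V)"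
      using w_nonneg by simp
    have "w V * \<bar>g V - 1\<bar> = (sqrt (w V) * sqrt (w V)) * (\<bar>sqrt (g V) - 1\<bar> * (sqrt (g V) + 1))"
      by (rule arg_cong2[OF root abs])
    then show "w V * \<bar>g V - 1\<bar> = (sqrt (w V) * \<bar>sqrt (g V) - 1\<bar>) * (sqrt (w V) * (sqrt (g V) + 1))"
      by (simp only: mult_ac)
  qed
  then have "d\<^sup>2 \<le> (\<Sum>V\<in>Pow I. (sqrt (w V) * \<bar>sqrt (g V) - 1\<bar>)\<^sup>2) * (\<Sum>V\<in>Pow I. (sqrt (w V) * (sqrt (g V) + 1))\<^sup>2)"
    by (simp only: Cauchy_Schwarz_ineq_sum)
  also have "(\<Sum>V\<in>Pow I. (sqrt (w V) * \<bar>sqrt (g V) - 1\<bar>)\<^sup>2) = 2 * Z - 2 * r"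
  proof -
    have "(\<Sum>V\<in>Pow I. (sqrt (w V) * \<bar>sqrt (g V) - 1\<bar>)\<^sup>2)
        = (\<Sum>V\<in>Pow I. w V * g V + w V - 2 * (w V * sqrt (g V)))"
      using sq w_nonneg
      by (intro sum.cong refl) (simp add: power_mult_distrib power2_diff algebra_simps)
    then show ?thesis
      by (simp add: sum_subtractf sum.distrib total r_def sum_distrib_left[symmetric] Z_def[symmetric])
  qed
  also have "(\<Sum>V\<in>Pow I. (sqrt (w V) * (sqrt (g V) + 1))\<^sup>2) = 2 * Z + 2 * r"
  proof -
    have "(\<Sum>V\<in>Pow I. (sqrt (w V) * (sqrt (g V) + 1))\<^sup>2)
        = (\<Sum>V\<in>Pow I. w V * g V + w V + 2 * (w V * sqrt (g V)))"
      using sq w_nonneg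
      by (intro sum.cong refl) (simp add: power_mult_distrib power2_sum algebra_simps)
    then show ?thesis
      by (simp add: sum.distrib total r_def sum_distrib_left[symmetric] Z_def[symmetric])
  qed
  finally have d2: "d\<^sup>2 \<le> (2 * Z - 2 * r) * (2 * Z + 2 * r)" .
  have r0: "r \<ge> 0"
    unfolding r_def using g w_nonneg by (intro sum_nonneg mult_nonneg_nonneg) auto
  have E: "2 * Z - 2 * r \<le> ent g"
  proof -
    have "(\<Sum>V\<in>Pow I. w V * (2 * g V - 2 * sqrt (g V))) \<le> ent g"
      unfolding ent_def
    proof (intro sum_mono mult_left_mono w_nonneg)
      fix V assume "V \<in> Pow I"
      then show "2 * g V - 2 * sqrt (g V) \<le> g V * ln (g V)"
        using xlnx_ge[of "g V" 1] g by simp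
    qed
    moreover have "(\<Sum>V\<in>Pow I. w V * (2 * g V - 2 * sqrt (g V)))
        = 2 * (\<Sum>V\<in>Pow I. w V * g V) - 2 * r"
      unfolding r_def sum_distrib_left sum_subtractf[symmetric]
      by (intro sum.cong refl) (simp add: algebra_simps)
    ultimately show ?thesis by (simp add: total)
  qed
  have "d\<^sup>2 \<le> 4 * Z * ent g"
  proof -
    have "(2 * Z - 2 * r) * (2 * Z + 2 * r) = 4 * Z * (2 * Z - 2 * r) - (2 * Z - 2 * r)\<^sup>2"
      by (simp add: power2_eq_square algebra_simps)
    also have "\<dots> \<le> 4 * Z * (2 * Z - 2 * r)" by simp
    also have "\<dots> \<le> 4 * Z * ent g"
      using E Z by (intro mult_left_mono) auto
    finally show ?thesis using d2 by linarith
  qed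
  also have "\<dots> \<le> 4 * Z * ((1 - 1 / (real n * K)) ^ t * (Z * ln Z))"
    using ent Z by (intro mult_left_mono) auto
  finally have "d\<^sup>2 \<le> (2 * Z)\<^sup>2 * ((1 - 1 / (real n * K)) ^ t * ln Z)"
    by (simp add: power2_eq_square mult_ac)
  then show ?thesis
    unfolding tv using Z by (simp add: power_divide field_simps)
qed

text \<open>The condition on \<open>t\<close> brings the contraction factor down to
  \<open>\<epsilon>\<^sup>2 / real n\<close>; the denominator pays for the initial entropy
  \<open>ln Z \<le> real n\<close>, as there are at most \<open>2 ^ n\<close> states.\<close>

lemma tv_dist_le:
  assumes S: "S \<in> states n A" and eps: "0 < \<epsilon>" "\<epsilon> < 1"
    and t: "real n * K * (ln (real n) + 2 * ln (1 / \<epsilon>)) \<le> real t"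
  shows "tv_dist (states n A) (kernel_power (states n A) (flip_repair n A) t S) (minor_measure n A) \<le> \<epsilon>"
proof -
  define x where "x = 1 / (real n * K)"
  have nK: "real n * K \<ge> 1"
    using n2 K_ge mult_mono[of 1 "real n" 1 K] by simp
  have x: "0 \<le> x" "x \<le> 1"
    using nK by (auto simp: x_def)
  have "(1 - x) ^ t \<le> exp (- x) ^ t"
    using x exp_ge_add_one_self[of "- x"] by (intro power_mono) auto
  also have "\<dots> = exp (- (x * real t))"
    by (simp add: exp_of_nat_mult[symmetric] mult.commute)
  also have "\<dots> \<le> exp (- (ln (real n) + 2 * ln (1 / \<epsilon>)))"
  proof -
    have "ln (real n) + 2 * ln (1 / \<epsilon>) \<le> x * real t"
      using t nK by (simp add: x_def field_simps)
    then show ?thesis by simp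
  qed
  also have "\<dots> = \<epsilon>\<^sup>2 / real n"
  proof -
    have "- (ln (real n) + 2 * ln (1 / \<epsilon>)) = ln (\<epsilon>\<^sup>2 / real n)"
      using eps n2 by (simp add: ln_div ln_realpow)
    then show ?thesis
      using eps n2 by simp
  qed
  finally have pow: "(1 - x) ^ t \<le> \<epsilon>\<^sup>2 / real n" .
  have lnZ: "0 \<le> ln Z" "ln Z \<le> real n"
  proof -
    show "0 \<le> ln Z" using Z_ge_1 by simp
    have "ln Z \<le> ln (2 ^ n)"
      using Z_le Z_ge_1 by (subst ln_le_cancel_iff) auto
    also have "\<dots> = real n * ln 2"
      by (simp add: ln_realpow)
    also have "\<dots> \<le> real n * 1"
      using ln_le_minus_one[of "2 :: real"] by (intro mult_left_mono) auto
    finally show "ln Z \<le> real n" by simp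
  qed
  have "(tv_dist (states n A) (kernel_power (states n A) (flip_repair n A) t S) (minor_measure n A))\<^sup>2
      \<le> (1 - x) ^ t * ln Z"
    using tv_dist_square[OF S, of t] by (simp add: x_def)
  also have "\<dots> \<le> (\<epsilon>\<^sup>2 / real n) * real n"
    using pow lnZ x by (intro mult_mono) auto
  also have "\<dots> = \<epsilon>\<^sup>2" using n2 by simp
  finally show ?thesis
    by (rule power2_le_imp_le) (use eps in simp)
qed

theorem mixing_time:
  assumes eps: "0 < \<epsilon>" "\<epsilon> < 1"
  shows "\<exists>\<tau>::nat. real \<tau> \<le> 11 * real n * ln (real n) * (1 + ln (real n) + ln (1 / \<epsilon>)) \<and>
     (\<forall>S\<in>states n A. \<forall>t\<ge>\<tau>.
       tv_dist (states n A) (kernel_power (states n A) (flip_repair n A) t S) (minor_measure n A) \<le> \<epsilon>)"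
proof (intro exI conjI ballI allI impI)
  define B where "B = real n * K * (ln (real n) + 2 * ln (1 / \<epsilon>))"
  define L where "L = ln (real n)"
  define E where "E = ln (1 / \<epsilon>)"
  have E0: "E \<ge> 0" using eps by (simp add: E_def)
  have L: "L \<ge> 1 / 2"
  proof -
    have "1 / 2 \<le> ln (2 :: real)"
      using ln_le_minus_one[of "1 / 2 :: real"] by (simp add: ln_div)
    also have "\<dots> \<le> L" using n2 by (simp add: L_def)
    finally show ?thesis .
  qed
  \<comment> \<open>The constant: \<open>K \<le> 5 * L\<close> because \<open>L \<ge> 1 / 2\<close>,
    and \<open>L + 2 * E \<le> 2 * (1 + L + E)\<close>, which makes 10. Rounding up adds less than
    1, and \<open>1 \<le> real n * L * (1 + L + E)\<close>.\<close>
  show "real (nat \<lceil>B\<rceil>) \<le> 11 * real n * ln (real n) * (1 + ln (real n) + ln (1 / \<epsilon>))"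
  proof -
    have B0: "B \<ge> 0"
      using n2 K_ge E0 L unfolding B_def E_def[symmetric] L_def[symmetric] by simp
    then have "real (nat \<lceil>B\<rceil>) \<le> B + 1"
      by linarith
    moreover have "B \<le> real n * (5 * L) * (2 * (1 + L + E))"
      unfolding B_def E_def[symmetric] L_def[symmetric]
      using L E0 by (intro mult_mono) (auto simp: K_def L_def)
    then have "B \<le> 10 * (real n * L * (1 + L + E))"
      by (simp only: mult_ac)
    moreover have "2 * (1 / 2) * 1 \<le> real n * L * (1 + L + E)"
      using n2 L E0 by (intro mult_mono) auto
    ultimately have "real (nat \<lceil>B\<rceil>) \<le> 11 * (real n * L * (1 + L + E))"
      by linarith
    then show ?thesis
      by (simp add: L_def E_def mult.assoc)
  qed
  fix S t assume S: "S \<in> states n A" and t: "nat \<lceil>B\<rceil> \<le> t"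
  have "B \<le> real t" using t by linarith
  then show "tv_dist (states n A) (kernel_power (states n A) (flip_repair n A) t S) (minor_measure n A) \<le> \<epsilon>"
    using S eps unfolding B_def by (intro tv_dist_le)
qed

end

lemma unit_minors_pfaffian:
  assumes n: "2 \<le> n" and A: "A \<in> carrier_mat n n" and skew: "transpose_mat A = - A"
    and unit: "\<forall>S. S \<subseteq> {0..<n} \<longrightarrow> minor_weight A S \<in> {0, 1}"
  shows "unit_minors n A (pfaffian (\<lambda>i j. if i < n \<and> j < n then A $$ (i, j) else 0) n)"
proof
  let ?a = "\<lambda>i j. if i < n \<and> j < n then A $$ (i, j) else 0"
  show weight: "minor_weight A S = (pfaffian ?a n S)\<^sup>2" if "S \<subseteq> {0..<n}" for S
    using minor_weight_pfaffian[OF A skew that] .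
  show "(pfaffian ?a n S)\<^sup>2 \<in> {0, 1}" if "S \<subseteq> {0..<n}" for S
    using unit that weight[OF that] by metis
  show "wick {0..<n} (pfaffian ?a n)"
    by (rule wick_row_expansion[OF row_expansion_pfaffian]) (rule skew_entries[OF A skew] finite_atLeastLessThan)+
qed (use n in \<open>simp_all add: pfaffian_empty\<close>)

theorem theorem4p2:
  shows "(\<forall>(n::nat) (A::real mat).
            n \<ge> 2 \<and> A \<in> carrier_mat n n \<and> transpose_mat A = - A \<and>
            (\<forall>S. S \<subseteq> {0..<n} \<longrightarrow> minor_weight A S \<in> {0, 1}) \<longrightarrow>
            (\<forall>f :: nat set \<Rightarrow> real.
               entropy (states n A) (minor_measure n A) (\<lambda>S. (f S)\<^sup>2)
                 \<le> real n * (ln (real n) + 2) *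
                    dirichlet_form (states n A) (minor_measure n A) (flip_repair n A) f))
       \<and> (\<exists>c::real. c > 0 \<and> (\<forall>(n::nat) (A::real mat).
            n \<ge> 2 \<and> A \<in> carrier_mat n n \<and> transpose_mat A = - A \<and>
            (\<forall>S. S \<subseteq> {0..<n} \<longrightarrow> minor_weight A S \<in> {0, 1}) \<longrightarrow>
            (\<forall>\<epsilon>::real. 0 < \<epsilon> \<and> \<epsilon> < 1 \<longrightarrow>
               (\<exists>\<tau>::nat. real \<tau> \<le> c * real n * ln (real n) * (1 + ln (real n) + ln (1 / \<epsilon>)) \<and>
                  (\<forall>S\<in>states n A. \<forall>t\<ge>\<tau>.
                     tv_dist (states n A)
                       (kernel_power (states n A) (flip_repair n A) t S)
                       (minor_measure n A) \<le> \<epsilon>)))))"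
proof (intro conjI exI[of _ "11 :: real"] allI impI)
  fix n :: nat and A :: "real mat" and f :: "nat set \<Rightarrow> real"
  assume "n \<ge> 2 \<and> A \<in> carrier_mat n n \<and> transpose_mat A = - A \<and>
            (\<forall>S. S \<subseteq> {0..<n} \<longrightarrow> minor_weight A S \<in> {0, 1})"
  then interpret unit_minors n A "pfaffian (\<lambda>i j. if i < n \<and> j < n then A $$ (i, j) else 0) n"
    by (intro unit_minors_pfaffian) auto
  show "entropy (states n A) (minor_measure n A) (\<lambda>S. (f S)\<^sup>2)
      \<le> real n * (ln (real n) + 2) *
         dirichlet_form (states n A) (minor_measure n A) (flip_repair n A) f"
    by (rule log_sobolev)
next
  fix n :: nat and A :: "real mat" and \<epsilon> :: real
  assume "n \<ge> 2 \<and> A \<in> carrier_mat n n \<and> transpose_mat A = - A \<and>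
            (\<forall>S. S \<subseteq> {0..<n} \<longrightarrow> minor_weight A S \<in> {0, 1})"
  then interpret unit_minors n A "pfaffian (\<lambda>i j. if i < n \<and> j < n then A $$ (i, j) else 0) n"
    by (intro unit_minors_pfaffian) auto
  assume "0 < \<epsilon> \<and> \<epsilon> < 1"
  then show "\<exists>\<tau>::nat. real \<tau> \<le> 11 * real n * ln (real n) * (1 + ln (real n) + ln (1 / \<epsilon>)) \<and>
     (\<forall>S\<in>states n A. \<forall>t\<ge>\<tau>.
       tv_dist (states n A) (kernel_power (states n A) (flip_repair n A) t S) (minor_measure n A) \<le> \<epsilon>)"
    by (intro mixing_time) auto
qed simp

end
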